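(* Let $\mathcal{C}$ be a permutation class containing $12$ and $21$ and containing only finitely many simple permutations. Let $B$ be the (finite) basis of $\mathcal{C}$, let $B^\star$ be the set of non-simple permutations in $B$, and let $\mathcal{S}_{\mathcal{C}}$ be the (finite) set of simple permutations in $\mathcal{C}$. There is an algorithm which, given $B$ and $\mathcal{S}_{\mathcal{C}}$, computes a finite system of combinatorial equations describing $\mathcal{C}$ with the following properties. Every equation is of the form $\mathcal{D}_0 = \{1\} \cup \bigcup \pi[\mathcal{D}_1,\dots,\mathcal{D}_n]$ (a finite union, each $\pi$ being $\oplus$, $\ominus$ or a simple permutation, $n=|\pi|$), and is a true equality of sets of permutations; each $\mathcal{D}_i$ occurring in the system is of the form $\hat{\mathcal{C}}^{\delta}\langle B^\star \cup B_i\rangle$ with $\delta \in \{\,\cdot\,, +, -\}$ (i.e. $\hat{\mathcal{C}}^\delta$ is $\hat{\mathcal{C}}$, $\hat{\mathcal{C}}^+$ or $\hat{\mathcal{C}}^-$) and $B_i$ a set consisting only of normalized blocks of elements of $B^\star$. The system contains an equation whose left part is $\mathcal{C}$, and it is complete: every $\mathcal{D}_i$ appearing in the system is the left part of some equation of the system.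
   Context: A permutation of size $n$ is a bijection of $\{1,\dots,n\}$, written as the word $\sigma_1\cdots\sigma_n$; $\varepsilon$ is the permutation of size $0$. For $\sigma$ of size $n$ and $I=\{i_1<\dots<i_k\}\subseteq\{1,\dots,n\}$, $\sigma_I$ is the permutation order-isomorphic to $\sigma_{i_1}\cdots\sigma_{i_k}$. A permutation $\pi$ is a pattern of $\sigma$ ($\pi\preccurlyeq\sigma$) if $\sigma_I=\pi$ for some $I$; otherwise $\sigma$ avoids $\pi$. A permutation class is a set of permutations of size $\ge 1$ closed under taking patterns; its basis is the set of $\preccurlyeq$-minimal permutations not in it. An interval of $\sigma$ is a nonempty set of consecutive indices $\{i,\dots,i+\ell-1\}$ whose images form a set of consecutive integers; a normalized block of $\sigma$ is $\sigma_I$ for $I$ an interval. A permutation is simple if it has size $\ge 4$ and its only intervals are the singletons and the whole index set. For $\sigma$ of size $n$ and nonempty permutations $\pi^1,\dots,\pi^n$, the substitution $\sigma[\pi^1,\dots,\pi^n]$ is the permutation obtained by concatenating sequences $S^1,\dots,S^n$, where $S^i$ is order-isomorphic to $\pi^i$ and consists of consecutive integers, and the entries of $S^i$ are smaller than those of $S^j$ iff $\sigma_i<\sigma_j$. Write $\oplus=12$, $\ominus=21$. A permutation is $\oplus$-indecomposable (resp. $\ominus$-indecomposable) if it cannot be written $\oplus[\pi^1,\pi^2]$ (resp. $\ominus[\pi^1,\pi^2]$). For sets $\mathcal{D}_1,\dots,\mathcal{D}_n$ of permutations, $\pi[\mathcal{D}_1,\dots,\mathcal{D}_n]=\{\pi[\sigma_1,\dots,\sigma_n]:\sigma_i\in\mathcal{D}_i\}$.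 The substitution closure of $\mathcal{C}$ is $\hat{\mathcal{C}}=\bigcup_{k\ge1}\mathcal{C}^k$ with $\mathcal{C}^1=\mathcal{C}$ and $\mathcal{C}^{k+1}=\{\sigma[\pi^1,\dots,\pi^{|\sigma|}]:\sigma\in\mathcal{C},\pi^i\in\mathcal{C}^k\}$. For a set $\mathcal{A}$ of permutations, $\mathcal{A}^+$ (resp. $\mathcal{A}^-$) is the set of its $\oplus$-indecomposable (resp. $\ominus$-indecomposable) elements, and $\mathcal{A}\langle E\rangle$ is the set of elements of $\mathcal{A}$ avoiding every pattern in $E$. $\{1\}$ denotes the set containing only the permutation of size $1$. *)

theory Defs
  imports Main "HOL-Library.Nat_Bijection"
begin

section \<open>Permutations as words\<close>

text \<open>
  A permutation of size \<open>n\<close> is the word of its values, which are \<open>1, \<dots>, n\<close>.  Positions are list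
  positions and therefore run over \<open>0, \<dots>, n - 1\<close>.
\<close>

type_synonym perm = "nat list"

definition is_perm :: "perm \<Rightarrow> bool" where
  "is_perm w \<longleftrightarrow> distinct w \<and> set w = {1..length w}"

definition order_iso :: "nat list \<Rightarrow> nat list \<Rightarrow> bool" where
  "order_iso xs ys \<longleftrightarrow> length xs = length ys \<and>
     (\<forall>i<length xs. \<forall>j<length xs. xs ! i < xs ! j \<longleftrightarrow> ys ! i < ys ! j)"

text \<open>
  \<open>std xs\<close> replaces every entry by its rank; \<open>is_perm_std\<close>, \<open>order_iso_std\<close> and
  \<open>order_iso_perm_unique\<close> below show that it is the permutation order-isomorphic to \<open>xs\<close>.
\<close>

definition std :: "nat list \<Rightarrow> perm" where
  "std xs = map (\<lambda>x. card {y \<in> set xs. y \<le> x}) xs"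

lemma rank_less_iff:
  fixes A :: "nat set"
  assumes "finite A" "x \<in> A" "x' \<in> A"
  shows "card {y \<in> A. y \<le> x} < card {y \<in> A. y \<le> x'} \<longleftrightarrow> x < x'"
proof -
  have mono: "card {y \<in> A. y \<le> a} < card {y \<in> A. y \<le> b}" if "a < b" "b \<in> A" for a b
  proof (rule psubset_card_mono)
    have "b \<in> {y \<in> A. y \<le> b}" "b \<notin> {y \<in> A. y \<le> a}" using that by auto
    moreover have "{y \<in> A. y \<le> a} \<subseteq> {y \<in> A. y \<le> b}" using that by auto
    ultimately show "{y \<in> A. y \<le> a} \<subset> {y \<in> A. y \<le> b}" by blast
  qed (use assms(1) in simp)
  show ?thesis
    using mono[of x x'] mono[of x' x] assms(2,3)
    by (cases x x' rule: linorder_cases) auto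
qed

lemma order_iso_std: "order_iso xs (std xs)"
  unfolding order_iso_def std_def by (simp add: rank_less_iff)

lemma is_perm_std:
  assumes "distinct xs"
  shows "is_perm (std xs)"
proof -
  let ?r = "\<lambda>x. card {y \<in> set xs. y \<le> x}"
  have inj: "inj_on ?r (set xs)"
  proof (rule inj_onI)
    fix x y assume "x \<in> set xs" "y \<in> set xs" "?r x = ?r y"
    then show "x = y"
      using rank_less_iff[of "set xs" x y] rank_less_iff[of "set xs" y x]
      by (cases x y rule: linorder_cases) auto
  qed
  have "?r ` set xs \<subseteq> {1..length xs}"
  proof (rule image_subsetI)
    fix x assume "x \<in> set xs"
    then have "{y \<in> set xs. y \<le> x} \<noteq> {}" by auto
    then have "1 \<le> ?r x" by (simp add: card_gt_0_iff Suc_le_eq del: Collect_empty_eq)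
    moreover have "?r x \<le> card (set xs)" by (rule card_mono) auto
    ultimately show "?r x \<in> {1..length xs}" using card_length[of xs] unfolding atLeastAtMost_iff by linarith
  qed
  moreover have "card (?r ` set xs) = card {1..length xs}"
    using inj assms by (simp add: card_image distinct_card)
  ultimately have "?r ` set xs = {1..length xs}" by (intro card_subset_eq) auto
  then show ?thesis
    using inj assms by (simp add: is_perm_def std_def distinct_map)
qed

lemma std_perm:
  assumes "is_perm w"
  shows "std w = w"
proof -
  have "card {y \<in> set w. y \<le> x} = x" if "x \<in> set w" for x
  proof -
    have "{y \<in> set w. y \<le> x} = {1..x}" using that assms by (auto simp: is_perm_def)
    then show ?thesis by simp
  qed
  then show ?thesis by (simp add: std_def map_idI)
qed

lemma std_cong:
  assumes iso: "order_iso xs ys" and "distinct xs" "distinct ys"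
  shows "std xs = std ys"
proof (rule nth_equalityI)
  show "length (std xs) = length (std ys)" using iso by (simp add: std_def order_iso_def)
  have rank: "card {y \<in> set zs. y \<le> zs ! i} = card {j. j < length zs \<and> zs ! j \<le> zs ! i}"
    if "distinct zs" for zs :: "nat list" and i
  proof -
    have "{y \<in> set zs. y \<le> zs ! i} = (!) zs ` {j. j < length zs \<and> zs ! j \<le> zs ! i}"
      by (auto simp: in_set_conv_nth)
    moreover have "inj_on ((!) zs) {j. j < length zs \<and> zs ! j \<le> zs ! i}"
      using that by (auto simp: inj_on_def nth_eq_iff_index_eq)
    ultimately show ?thesis by (simp add: card_image)
  qed
  fix i assume "i < length (std xs)"
  then have i: "i < length xs" "i < length ys" using iso by (auto simp: std_def order_iso_def)
  have "{j. j < length xs \<and> xs ! j \<le> xs ! i} = {j. j < length ys \<and> ys ! j \<le> ys ! i}"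
    using iso i unfolding order_iso_def not_less[symmetric] by auto
  then show "std xs ! i = std ys ! i"
    using i rank[OF assms(2)] rank[OF assms(3)] by (simp add: std_def)
qed

lemma order_iso_perm_unique:
  assumes "distinct xs" "is_perm w" "order_iso xs w"
  shows "w = std xs"
  using std_cong[of xs w] std_perm[of w] assms by (simp add: is_perm_def)

definition subperm :: "perm \<Rightarrow> nat set \<Rightarrow> perm" where
  "subperm \<sigma> I = std (nths \<sigma> I)"

definition is_pattern :: "perm \<Rightarrow> perm \<Rightarrow> bool" where
  "is_pattern \<pi> \<sigma> \<longleftrightarrow> (\<exists>I \<subseteq> {..<length \<sigma>}. subperm \<sigma> I = \<pi>)"

definition avoids :: "perm \<Rightarrow> perm \<Rightarrow> bool" where
  "avoids \<sigma> \<pi> \<longleftrightarrow> \<not> is_pattern \<pi> \<sigma>"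

text \<open>
  Classes contain no empty permutation, so closure under patterns and minimality in the basis
  range over nonempty permutations only (otherwise \<open>[]\<close> would be the basis of every class).
\<close>

definition perm_class :: "perm set \<Rightarrow> bool" where
  "perm_class \<C> \<longleftrightarrow> (\<forall>\<sigma>\<in>\<C>. is_perm \<sigma> \<and> \<sigma> \<noteq> []) \<and>
     (\<forall>\<sigma>\<in>\<C>. \<forall>\<pi>. \<pi> \<noteq> [] \<and> is_pattern \<pi> \<sigma> \<longrightarrow> \<pi> \<in> \<C>)"

definition basis :: "perm set \<Rightarrow> perm set" where
  "basis \<C> = {\<beta>. is_perm \<beta> \<and> \<beta> \<noteq> [] \<and> \<beta> \<notin> \<C> \<and>
     (\<forall>\<pi>. is_perm \<pi> \<and> \<pi> \<noteq> [] \<and> \<pi> \<notin> \<C> \<and> is_pattern \<pi> \<beta> \<longrightarrow> \<pi> = \<beta>)}"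

definition is_interval :: "perm \<Rightarrow> nat set \<Rightarrow> bool" where
  "is_interval \<sigma> I \<longleftrightarrow> I \<noteq> {} \<and> I \<subseteq> {..<length \<sigma>} \<and>
     (\<exists>i j. I = {i..<j}) \<and> (\<exists>a b. (!) \<sigma> ` I = {a..<b})"

definition normalized_block :: "perm \<Rightarrow> perm \<Rightarrow> bool" where
  "normalized_block \<pi> \<sigma> \<longleftrightarrow> (\<exists>I. is_interval \<sigma> I \<and> \<pi> = subperm \<sigma> I)"

definition simple_perm :: "perm \<Rightarrow> bool" where
  "simple_perm \<sigma> \<longleftrightarrow> is_perm \<sigma> \<and> length \<sigma> \<ge> 4 \<and>
     (\<forall>I. is_interval \<sigma> I \<longrightarrow> (\<exists>i. I = {i}) \<or> I = {..<length \<sigma>})"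


section \<open>Substitution\<close>

text \<open>
  The block at position \<open>i\<close> is shifted by the total size of the blocks lying below it.
\<close>

definition inflate :: "perm \<Rightarrow> perm list \<Rightarrow> perm" where
  "inflate \<sigma> \<pi>s = concat (map (\<lambda>i.
     map (\<lambda>x. x + (\<Sum>j \<in> {j \<in> {..<length \<sigma>}. \<sigma> ! j < \<sigma> ! i}. length (\<pi>s ! j))) (\<pi>s ! i))
     [0..<length \<sigma>])"

abbreviation (input) oplus :: perm where "oplus \<equiv> [1, 2]"
abbreviation (input) ominus :: perm where "ominus \<equiv> [2, 1]"

definition decomposable_by :: "perm \<Rightarrow> perm \<Rightarrow> bool" where
  "decomposable_by \<rho> \<sigma> \<longleftrightarrow> (\<exists>\<pi>1 \<pi>2. is_perm \<pi>1 \<and> \<pi>1 \<noteq> [] \<and> is_perm \<pi>2 \<and> \<pi>2 \<noteq> [] \<and>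
     \<sigma> = inflate \<rho> [\<pi>1, \<pi>2])"

definition inflate_sets :: "perm \<Rightarrow> perm set list \<Rightarrow> perm set" where
  "inflate_sets \<pi> Ds = {inflate \<pi> \<sigma>s | \<sigma>s. list_all2 (\<in>) \<sigma>s Ds}"

text \<open>\<open>subst_power \<C> k\<close> is \<open>\<C>\<^sup>k\<^sup>+\<^sup>1\<close>.\<close>

fun subst_power :: "perm set \<Rightarrow> nat \<Rightarrow> perm set" where
  "subst_power \<C> 0 = \<C>"
| "subst_power \<C> (Suc k) = {inflate \<sigma> \<pi>s | \<sigma> \<pi>s.
     \<sigma> \<in> \<C> \<and> length \<pi>s = length \<sigma> \<and> set \<pi>s \<subseteq> subst_power \<C> k}"

definition subst_closure :: "perm set \<Rightarrow> perm set" where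
  "subst_closure \<C> = (\<Union>k. subst_power \<C> k)"

datatype delta = Full | Plus | Minus

fun delta_part :: "delta \<Rightarrow> perm set \<Rightarrow> perm set" where
  "delta_part Full A = A"
| "delta_part Plus A = {\<sigma> \<in> A. \<not> decomposable_by oplus \<sigma>}"
| "delta_part Minus A = {\<sigma> \<in> A. \<not> decomposable_by ominus \<sigma>}"

definition avoiders :: "perm set \<Rightarrow> perm set \<Rightarrow> perm set" where
  "avoiders A E = {\<sigma> \<in> A. \<forall>\<pi>\<in>E. avoids \<sigma> \<pi>}"

definition simples :: "perm set \<Rightarrow> perm set" where
  "simples \<C> = {\<sigma> \<in> \<C>. simple_perm \<sigma>}"

definition basis_star :: "perm set \<Rightarrow> perm set" where
  "basis_star \<C> = {\<beta> \<in> basis \<C>. \<not> simple_perm \<beta>}"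


section \<open>Systems of combinatorial equations\<close>

text \<open>
  A system is a syntactic object.  The unknown \<open>(\<delta>, Bs)\<close> is a name for the set
  \<open>\<C>hat\<^sup>\<delta>\<langle>B\<^sup>\<star> \<union> set Bs\<rangle>\<close>; the equation \<open>(D0, [(\<pi>, [D1, \<dots>, Dn]), \<dots>])\<close> stands for
  \<open>D0 = {1} \<union> \<pi>[D1, \<dots>, Dn] \<union> \<dots>\<close>.
\<close>

type_synonym unknown = "delta \<times> perm list"
type_synonym summand = "perm \<times> unknown list"
type_synonym equation = "unknown \<times> summand list"
type_synonym eq_system = "equation list"

fun denotes :: "perm set \<Rightarrow> unknown \<Rightarrow> perm set" where
  "denotes \<C> (\<delta>, Bs) = avoiders (delta_part \<delta> (subst_closure \<C>)) (basis_star \<C> \<union> set Bs)"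

definition lhs_unknowns :: "eq_system \<Rightarrow> unknown set" where
  "lhs_unknowns sys = fst ` set sys"

definition unknowns :: "eq_system \<Rightarrow> unknown set" where
  "unknowns sys = lhs_unknowns sys \<union> (\<Union>(D, Ts) \<in> set sys. \<Union>(\<pi>, Ds) \<in> set Ts. set Ds)"

fun summand_ok :: "summand \<Rightarrow> bool" where
  "summand_ok (\<pi>, Ds) \<longleftrightarrow>
     (\<pi> = oplus \<or> \<pi> = ominus \<or> simple_perm \<pi>) \<and> length Ds = length \<pi>"

fun equation_holds :: "perm set \<Rightarrow> equation \<Rightarrow> bool" where
  "equation_holds \<C> (D, Ts) \<longleftrightarrow>
     denotes \<C> D = {[1]} \<union> (\<Union>(\<pi>, Ds) \<in> set Ts. inflate_sets \<pi> (map (denotes \<C>) Ds))"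


section \<open>Algorithms\<close>

text \<open>
  Programs for the partial recursive functions, as unary functions on the natural numbers
  with the pairing function \<^const>\<open>prod_encode\<close>.  \<open>computes p x y\<close> says that \<open>p\<close> halts on
  input \<open>x\<close> with output \<open>y\<close>.
\<close>

datatype program =
    Zero
  | Succ
  | Fst
  | Snd
  | Pairing program program
  | Comp program program
  | PrimRec program program
  | Search program

inductive computes :: "program \<Rightarrow> nat \<Rightarrow> nat \<Rightarrow> bool" where
  "computes Zero x 0"
| "computes Succ x (Suc x)"
| "computes Fst (prod_encode (x, y)) x"
| "computes Snd (prod_encode (x, y)) y"
| "computes p x a \<Longrightarrow> computes q x b \<Longrightarrow> computes (Pairing p q) x (prod_encode (a, b))"
| "computes q x a \<Longrightarrow> computes p a b \<Longrightarrow> computes (Comp p q) x b"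
| "computes p x a \<Longrightarrow> computes (PrimRec p q) (prod_encode (x, 0)) a"
| "computes (PrimRec p q) (prod_encode (x, n)) a \<Longrightarrow>
     computes q (prod_encode (x, prod_encode (n, a))) b \<Longrightarrow>
     computes (PrimRec p q) (prod_encode (x, Suc n)) b"
| "computes p (prod_encode (x, n)) 0 \<Longrightarrow>
     (\<And>m. m < n \<Longrightarrow> \<exists>a. computes p (prod_encode (x, m)) (Suc a)) \<Longrightarrow>
     computes (Search p) x n"

inductive_cases computes_ZeroE: "computes Zero x y"
inductive_cases computes_SuccE: "computes Succ x y"
inductive_cases computes_FstE: "computes Fst x y"
inductive_cases computes_SndE: "computes Snd x y"
inductive_cases computes_PairingE: "computes (Pairing p q) x y"
inductive_cases computes_CompE: "computes (Comp p q) x y"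
inductive_cases computes_PrimRecE: "computes (PrimRec p q) x y"
inductive_cases computes_SearchE: "computes (Search p) x y"

lemma computes_deterministic:
  "computes p x y \<Longrightarrow> computes p x z \<Longrightarrow> y = z"
proof (induction p x y arbitrary: z rule: computes.induct)
  case (1 x)
  then show ?case by (auto elim: computes_ZeroE)
next
  case (2 x)
  then show ?case by (auto elim: computes_SuccE)
next
  case (3 x y)
  then show ?case by (auto elim!: computes_FstE)
next
  case (4 x y)
  then show ?case by (auto elim!: computes_SndE)
next
  case (5 p x a q b)
  from 5(5) show ?case by (rule computes_PairingE) (use 5(3,4) in blast)
next
  case (6 q x a p b)
  from 6(5) show ?case by (rule computes_CompE) (use 6(3,4) in blast)
next
  case (7 p x a q)
  from 7(3) show ?case by (rule computes_PrimRecE) (use 7(2) in simp_all)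
next
  case (8 p q x n a b)
  from 8(5) show ?case
  proof (rule computes_PrimRecE)
    fix x' n' a'
    assume eq: "prod_encode (x, Suc n) = prod_encode (x', Suc n')"
      and a': "computes (PrimRec p q) (prod_encode (x', n')) a'"
      and z: "computes q (prod_encode (x', prod_encode (n', a'))) z"
    from eq have "x' = x" "n' = n" by simp_all
    with a' z 8(3)[of a'] 8(4)[of z] show "b = z" by simp
  qed simp
next
  case (9 p x n)
  from 9(4) have z0: "computes p (prod_encode (x, z)) 0"
    and zS: "\<And>m. m < z \<Longrightarrow> \<exists>a. computes p (prod_encode (x, m)) (Suc a)"
    by (blast elim: computes_SearchE)+
  have "\<not> n < z" using zS[of n] 9(2) by (metis nat.distinct(1))
  moreover have "\<not> z < n" using 9(3)[of z] z0 by (metis nat.distinct(1))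
  ultimately show ?case by simp
qed

abbreviation perm_code :: "perm \<Rightarrow> nat" where
  "perm_code \<equiv> list_encode"

definition perms_code :: "perm list \<Rightarrow> nat" where
  "perms_code ps = list_encode (map perm_code ps)"

fun delta_code :: "delta \<Rightarrow> nat" where
  "delta_code Full = 0"
| "delta_code Plus = 1"
| "delta_code Minus = 2"

fun unknown_code :: "unknown \<Rightarrow> nat" where
  "unknown_code (\<delta>, Bs) = prod_encode (delta_code \<delta>, perms_code Bs)"

fun summand_code :: "summand \<Rightarrow> nat" where
  "summand_code (\<pi>, Ds) = prod_encode (perm_code \<pi>, list_encode (map unknown_code Ds))"

fun equation_code :: "equation \<Rightarrow> nat" where
  "equation_code (D, Ts) = prod_encode (unknown_code D, list_encode (map summand_code Ts))"

definition system_code :: "eq_system \<Rightarrow> nat" where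
  "system_code sys = list_encode (map equation_code sys)"

definition input_code :: "perm list \<Rightarrow> perm list \<Rightarrow> nat" where
  "input_code bs ss = prod_encode (perms_code bs, perms_code ss)"

end

theory Submission
  imports Defs "HOL-Library.Sublist"
begin

text \<open>
  The simple patterns of the substitution closure of \<open>\<C>\<close> lie in \<open>\<C>\<close>, hence the closure restricted to
  the avoiders of \<open>B\<^sup>\<star>\<close> is \<open>\<C>\<close> itself.  Every \<open>\<sigma> \<in> \<C>\<close> of size at least 2 is \<open>\<pi>[\<sigma>\<^sub>1, \<dots>, \<sigma>\<^sub>n]\<close> with \<open>\<pi>\<close>
  equal to \<open>12\<close>, \<open>21\<close> or simple, and \<open>\<beta>\<close> is a pattern of such a substitution iff \<open>\<beta>\<close> splits
  into consecutive, possibly empty, blocks \<open>\<beta>\<^sub>1, \<dots>, \<beta>\<^sub>n\<close> arranged like \<open>\<pi>\<close> with each \<open>\<beta>\<^sub>i\<close> a pattern of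
  \<open>\<sigma>\<^sub>i\<close>.  So \<open>\<sigma>\<close> avoids a set of patterns iff every splitting of every pattern has a block
  \<open>\<beta>\<^sub>i\<close> that \<open>\<sigma>\<^sub>i\<close> avoids.  These blocks are blocks of elements of \<open>B\<close>; recording for each \<open>\<sigma>\<^sub>i\<close> the set of
  all such blocks it avoids yields the summands.  As the unions need not be disjoint, the
  unknowns with \<open>\<delta>\<close> empty suffice.
\<close>

section \<open>Computable functions\<close>

definition recursive :: "(nat \<Rightarrow> nat) \<Rightarrow> bool" where
  "recursive f \<longleftrightarrow> (\<exists>p. \<forall>x. computes p x (f x))"

lemma recursive_const: "recursive (\<lambda>x. c)"
proof (induction c)
  case 0
  show ?case unfolding recursive_def by (blast intro: computes.intros)
next
  case (Suc c)
  then show ?case unfolding recursive_def by (blast intro: computes.intros)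
qed

lemma recursive_Suc: "recursive Suc"
  unfolding recursive_def by (blast intro: computes.intros)

lemma recursive_fst: "recursive (\<lambda>x. fst (prod_decode x))"
proof -
  have "computes Fst x (fst (prod_decode x))" for x
    using computes.intros(3)[of "fst (prod_decode x)" "snd (prod_decode x)"] by simp
  then show ?thesis unfolding recursive_def by blast
qed

lemma recursive_snd: "recursive (\<lambda>x. snd (prod_decode x))"
proof -
  have "computes Snd x (snd (prod_decode x))" for x
    using computes.intros(4)[of "fst (prod_decode x)" "snd (prod_decode x)"] by simp
  then show ?thesis unfolding recursive_def by blast
qed

lemma recursive_pair:
  "recursive f \<Longrightarrow> recursive g \<Longrightarrow> recursive (\<lambda>x. prod_encode (f x, g x))"
  unfolding recursive_def by (blast intro: computes.intros)

lemma recursive_comp: "recursive f \<Longrightarrow> recursive g \<Longrightarrow> recursive (\<lambda>x. f (g x))"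
  unfolding recursive_def by (blast intro: computes.intros)

lemma recursive_id: "recursive (\<lambda>x. x)"
  using recursive_pair[OF recursive_fst recursive_snd] by simp

text \<open>The step function receives parameter, counter and previous value as one nested pair, the
  argument format of \<open>PrimRec\<close>. The depth \<open>h x\<close> may depend on
  \<open>x\<close>, hence the final composition with the pair of \<open>x\<close> and
  \<open>h x\<close>.\<close>

lemma recursive_rec_nat:
  assumes "recursive f" "recursive g" "recursive h"
  shows "recursive (\<lambda>x. rec_nat (f x) (\<lambda>n a. g (prod_encode (x, prod_encode (n, a)))) (h x))"
proof -
  obtain p q where p: "\<And>x. computes p x (f x)" and q: "\<And>x. computes q x (g x)"
    using assms unfolding recursive_def by blast
  let ?R = "\<lambda>x. rec_nat (f x) (\<lambda>n a. g (prod_encode (x, prod_encode (n, a))))"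
  have "computes (PrimRec p q) (prod_encode (x, n)) (?R x n)" for x n
  proof (induction n)
    case 0
    show ?case using p by (auto intro: computes.intros)
  next
    case (Suc n)
    show ?case using computes.intros(8)[OF Suc q] by simp
  qed
  then have "computes (PrimRec p q) y (?R (fst (prod_decode y)) (snd (prod_decode y)))" for y
    by (metis prod.collapse prod_decode_inverse)
  then have "recursive (\<lambda>y. ?R (fst (prod_decode y)) (snd (prod_decode y)))"
    unfolding recursive_def by blast
  from recursive_comp[OF this recursive_pair[OF recursive_id assms(3)]] show ?thesis by simp
qed

section \<open>Computability over encoded data types\<close>

class encodable =
  fixes encode :: "'a \<Rightarrow> nat"
  assumes encode_inject: "encode x = encode y \<longleftrightarrow> x = y"

instantiation nat :: encodable
begin
definition encode_nat :: "nat \<Rightarrow> nat" where [simp]: "encode_nat n = n"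
instance by standard simp
end

instantiation bool :: encodable
begin
definition encode_bool :: "bool \<Rightarrow> nat" where "encode_bool b = (if b then 1 else 0)"
instance by standard (simp add: encode_bool_def)
end

instantiation delta :: encodable
begin
definition encode_delta :: "delta \<Rightarrow> nat" where "encode_delta = delta_code"
instance
proof
  show "encode x = encode y \<longleftrightarrow> x = y" for x y :: delta
    by (cases x; cases y) (simp_all add: encode_delta_def)
qed
end

instantiation prod :: (encodable, encodable) encodable
begin
definition encode_prod :: "'a \<times> 'b \<Rightarrow> nat" where
  "encode_prod z = prod_encode (encode (fst z), encode (snd z))"
instance by standard (auto simp: encode_prod_def encode_inject)
end

text \<open>Going through \<open>list_encode\<close> makes the generic encoding agree with the codes
  fixed for the input and output of the algorithm.\<close>

instantiation list :: (encodable) encodable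
begin
definition encode_list :: "'a list \<Rightarrow> nat" where
  "encode_list xs = list_encode (map encode xs)"
instance
proof
  show "encode xs = encode ys \<longleftrightarrow> xs = ys" for xs ys :: "'a list"
    by (auto simp: encode_list_def list_encode_eq encode_inject inj_def
        dest!: map_injective)
qed
end

lemma encode_Pair [simp]: "encode (x, y) = prod_encode (encode x, encode y)"
  by (simp add: encode_prod_def)

lemma encode_Nil [simp]: "encode [] = 0"
  by (simp add: encode_list_def)

lemma encode_Cons [simp]: "encode (x # xs) = Suc (prod_encode (encode x, encode xs))"
  by (simp add: encode_list_def)

text \<open>
  The witness \<open>F\<close> is total on all numbers, codes or not: primitive recursion over a code runs
  through numbers that need not be codes.
\<close>

definition computable :: "('a::encodable \<Rightarrow> 'b::encodable) \<Rightarrow> bool" where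
  "computable f \<longleftrightarrow> (\<exists>F. recursive F \<and> (\<forall>x. F (encode x) = encode (f x)))"

lemma computableI: "recursive F \<Longrightarrow> (\<And>x. F (encode x) = encode (f x)) \<Longrightarrow> computable f"
  unfolding computable_def by blast

lemma computable_const: "computable (\<lambda>x. c)"
  by (rule computableI[OF recursive_const]) simp

lemma computable_id: "computable (\<lambda>x. x)"
  by (rule computableI[OF recursive_id]) simp

lemma computable_comp:
  assumes "computable f" "computable g"
  shows "computable (\<lambda>x. f (g x))"
proof -
  obtain F where F: "recursive F" "\<And>x. F (encode x) = encode (f x)" using assms(1) unfolding computable_def by blast
  obtain G where G: "recursive G" "\<And>x. G (encode x) = encode (g x)" using assms(2) unfolding computable_def by blast
  show ?thesis by (rule computableI[OF recursive_comp[OF F(1) G(1)]]) (simp add: F G)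
qed

lemma computable_Pair:
  assumes "computable f" "computable g"
  shows "computable (\<lambda>x. (f x, g x))"
proof -
  obtain F where F: "recursive F" "\<And>x. F (encode x) = encode (f x)" using assms(1) unfolding computable_def by blast
  obtain G where G: "recursive G" "\<And>x. G (encode x) = encode (g x)" using assms(2) unfolding computable_def by blast
  show ?thesis by (rule computableI[OF recursive_pair[OF F(1) G(1)]]) (simp add: F G)
qed

lemma computable_fst: "computable f \<Longrightarrow> computable (\<lambda>x. fst (f x))"
  by (rule computable_comp[of fst f], rule computableI[OF recursive_fst]) (simp add: encode_prod_def)

lemma computable_snd: "computable f \<Longrightarrow> computable (\<lambda>x. snd (f x))"
  by (rule computable_comp[of snd f], rule computableI[OF recursive_snd]) (simp add: encode_prod_def)

lemma computable_Suc: "computable f \<Longrightarrow> computable (\<lambda>x. Suc (f x))"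
  by (rule computable_comp[of Suc f], rule computableI[OF recursive_Suc]) simp

text \<open>The identity is the witness, since a number is its own code. Codes thereby become
  available as numbers: as recursion bounds and for comparisons.\<close>

lemma computable_encode: "computable f \<Longrightarrow> computable (\<lambda>x. encode (f x))"
  by (rule computable_comp[of encode f], rule computableI[OF recursive_id]) simp

lemma computable_rec_nat:
  assumes "computable f" "computable (\<lambda>z. g (fst z) (fst (snd z)) (snd (snd z)))" "computable h"
  shows "computable (\<lambda>x. rec_nat (f x) (g x) (h x))"
proof -
  let ?g = "\<lambda>z. g (fst z) (fst (snd z)) (snd (snd z))"
  obtain F where F: "recursive F" "\<And>x. F (encode x) = encode (f x)" using assms(1) unfolding computable_def by blast
  obtain G where G: "recursive G" "\<And>x. G (encode x) = encode (?g x)"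
    using assms(2) unfolding computable_def by blast
  obtain H where H: "recursive H" "\<And>x. H (encode x) = encode (h x)" using assms(3) unfolding computable_def by blast
  have "rec_nat (F (encode x)) (\<lambda>n a. G (prod_encode (encode x, prod_encode (n, a)))) n
      = encode (rec_nat (f x) (g x) n)" for x n
  proof (induction n)
    case 0
    show ?case by (simp add: F)
  next
    case (Suc n)
    then show ?case using G(2)[of "(x, n, rec_nat (f x) (g x) n)"] by simp
  qed
  then show ?thesis
    by (intro computableI[OF recursive_rec_nat[OF F(1) G(1) H(1)]]) (simp add: H)
qed

text \<open>A list code is \<open>0\<close> or the successor of the pair of the codes of head and
  tail. Recursion on the code therefore acts as a case distinction: its last step sees that pair as
  the counter.\<close>

lemma computable_case_list:
  assumes "computable f" "computable (\<lambda>z. g (fst z) (fst (snd z)) (snd (snd z)))" "computable h"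
  shows "computable (\<lambda>x. case h x of [] \<Rightarrow> f x | a # as \<Rightarrow> g x a as)"
proof -
  let ?g = "\<lambda>z. g (fst z) (fst (snd z)) (snd (snd z))"
  obtain F where F: "recursive F" "\<And>x. F (encode x) = encode (f x)" using assms(1) unfolding computable_def by blast
  obtain G where G: "recursive G" "\<And>x. G (encode x) = encode (?g x)"
    using assms(2) unfolding computable_def by blast
  obtain H where H: "recursive H" "\<And>x. H (encode x) = encode (h x)" using assms(3) unfolding computable_def by blast
  \<comment> \<open>The accumulated value is dropped; only the parameter and the counter, which is
    the pair of head and tail, are passed on.\<close>
  let ?G = "\<lambda>y. G (prod_encode (fst (prod_decode y), fst (prod_decode (snd (prod_decode y)))))"
  have "recursive ?G"
    by (intro recursive_comp[OF G(1)] recursive_pair recursive_fst recursive_comp[OF recursive_fst recursive_snd])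
  from recursive_rec_nat[OF F(1) this H(1)] show ?thesis
  proof (rule computableI)
    fix x
    show "rec_nat (F (encode x))
        (\<lambda>n a. ?G (prod_encode (encode x, prod_encode (n, a)))) (H (encode x)) =
        encode (case h x of [] \<Rightarrow> f x | a # as \<Rightarrow> g x a as)"
    proof (cases "h x")
      case Nil
      then show ?thesis by (simp add: F H)
    next
      case (Cons a as)
      then show ?thesis using G(2)[of "(x, a, as)"] by (simp add: H)
    qed
  qed
qed

lemma computable_Cons:
  assumes "computable f" "computable g"
  shows "computable (\<lambda>x. f x # g x)"
proof -
  have "computable (\<lambda>z :: 'b \<times> 'b list. fst z # snd z)"
    by (rule computableI[OF recursive_Suc]) (simp add: encode_prod_def)
  from computable_comp[OF this computable_Pair[OF assms]] show ?thesis by simp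
qed

text \<open>Makes the code of a list usable as the number of rounds of a loop over that
  list.\<close>

lemma length_le_encode: "length xs \<le> encode xs"
proof (induction xs)
  case (Cons x xs)
  then show ?case using le_prod_encode_2[of "encode xs" "encode x"] by simp
qed simp

text \<open>A loop whose state is the accumulator with the remaining list. It runs for as many
  rounds as the code of the list, which is at least its length; once the list is exhausted the state
  stays fixed.\<close>

lemma computable_fold:
  assumes "computable l" "computable i"
    and "computable (\<lambda>z. g (fst z) (fst (snd z)) (snd (snd z)))"
  shows "computable (\<lambda>x. fold (g x) (l x) (i x))"
proof -
  let ?step = "\<lambda>x n st. case snd st of [] \<Rightarrow> st | a # as \<Rightarrow> (g x a (fst st), as)"
  have run: "rec_nat (s, as) (?step x) n = (fold (g x) (take n as) s, drop n as)" for x s as n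
  proof (induction n)
    case (Suc n)
    show ?case
    proof (cases "drop n as")
      case Nil
      then show ?thesis using Suc by simp
    next
      case (Cons b bs)
      then have "n < length as" "b = as ! n" "bs = drop (Suc n) as"
        by (metis drop_eq_Nil linorder_not_less list.distinct(1), metis nth_via_drop, metis drop_Suc list.sel(3) tl_drop)
      then show ?thesis using Suc Cons by (simp add: take_Suc_conv_app_nth)
    qed
  qed simp
  have "computable (\<lambda>x. fst (rec_nat (i x, l x) (?step x) (encode (l x))))"
    by (intro computable_fst computable_rec_nat computable_Pair assms(1,2) computable_encode
        computable_case_list computable_snd computable_id
        computable_comp[OF assms(3), of "\<lambda>z. (fst (fst z), fst (snd z), fst (snd (snd (fst z))))", simplified])
  then show ?thesis
    by (simp add: run length_le_encode)
qed

text \<open>The code of a truth value is \<open>0\<close> or \<open>1\<close>, so recursion on it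
  runs zero rounds or one.\<close>

lemma computable_if:
  assumes "computable b" "computable f" "computable g"
  shows "computable (\<lambda>x. if b x then f x else g x)"
proof -
  have "computable (\<lambda>x. rec_nat (g x) (\<lambda>_ _. f x) (encode (b x)))"
    by (intro computable_rec_nat computable_encode assms computable_comp[OF assms(2)]
        computable_fst computable_id)
  moreover have "rec_nat (g x) (\<lambda>_ _. f x) (encode (b x)) = (if b x then f x else g x)" for x
    by (simp add: encode_bool_def)
  ultimately show ?thesis by simp
qed

lemma computable_conj:
  assumes "computable f" "computable g"
  shows "computable (\<lambda>x. f x \<and> g x)"
proof -
  have "(\<lambda>x. f x \<and> g x) = (\<lambda>x. if f x then g x else False)" by auto
  then show ?thesis by (simp only: computable_if computable_const assms)
qed

lemma computable_imp:
  "computable f \<Longrightarrow> computable g \<Longrightarrow> computable (\<lambda>x. f x \<longrightarrow> g x)"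
  using computable_if[of f g "\<lambda>x. True"] by (simp add: computable_const if_bool_eq_conj)

lemma computable_not: "computable f \<Longrightarrow> computable (\<lambda>x. \<not> f x)"
  using computable_imp[of f "\<lambda>x. False"] by (simp add: computable_const)

lemma computable_diff:
  fixes f g :: "'a::encodable \<Rightarrow> nat"
  assumes "computable f" "computable g"
  shows "computable (\<lambda>x. f x - g x)"
proof -
  have pred: "computable (\<lambda>x. h x - 1)" if "computable h" for h :: "'b::encodable \<Rightarrow> nat"
  proof -
    have "computable (\<lambda>x. rec_nat 0 (\<lambda>n _. n) (h x))"
      by (intro computable_rec_nat computable_const computable_fst computable_snd computable_id that)
    moreover have "rec_nat 0 (\<lambda>n _. n) m = m - 1" for m :: nat by (cases m) simp_all
    ultimately show ?thesis by simp
  qed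
  have "computable (\<lambda>x. rec_nat (f x) (\<lambda>_ a. a - 1) (g x))"
    by (intro computable_rec_nat pred assms computable_snd computable_id)
  moreover have "rec_nat m (\<lambda>_ a. a - 1) n = m - n" for m n :: nat by (induction n) simp_all
  ultimately show ?thesis by simp
qed

lemma computable_less:
  fixes f g :: "'a::encodable \<Rightarrow> nat"
  assumes "computable f" "computable g"
  shows "computable (\<lambda>x. f x < g x)"
proof -
  have "computable (\<lambda>x. rec_nat False (\<lambda>_ _. True) (g x - f x))"
    by (intro computable_rec_nat computable_const computable_diff assms)
  moreover have "rec_nat False (\<lambda>_ _. True) (n - m) \<longleftrightarrow> m < n" for m n :: nat
    by (cases "n - m") auto
  ultimately show ?thesis by simp
qed

lemma computable_le:
  fixes f g :: "'a::encodable \<Rightarrow> nat"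
  shows "computable f \<Longrightarrow> computable g \<Longrightarrow> computable (\<lambda>x. f x \<le> g x)"
  using computable_not[OF computable_less[of g f]] by (simp add: not_less)

text \<open>Encodings are injective, so equality of values is equality of codes, which two
  comparisons of numbers decide.\<close>

lemma computable_eq:
  assumes "computable f" "computable g"
  shows "computable (\<lambda>x. f x = g x)"
proof -
  have "computable (\<lambda>x. encode (f x) \<le> encode (g x) \<and> encode (g x) \<le> encode (f x))"
    by (intro computable_conj computable_le computable_encode assms)
  then show ?thesis by (simp add: order_eq_iff[symmetric] encode_inject)
qed

named_theorems computable_intros
lemmas [computable_intros] = computable_const computable_id computable_Pair computable_fst
  computable_snd computable_Suc computable_Cons computable_fold computable_if computable_conj
  computable_imp computable_not computable_less computable_le computable_eq

section \<open>List functions as folds\<close>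

lemma computable_rev [computable_intros]:
  assumes "computable f"
  shows "computable (\<lambda>x. rev (f x))"
proof -
  have "computable (\<lambda>x. fold (\<lambda>a s. a # s) (f x) [])"
    by (intro computable_intros assms)
  then show ?thesis by (simp add: fold_Cons_rev)
qed

lemma computable_append [computable_intros]:
  assumes "computable f" "computable g"
  shows "computable (\<lambda>x. f x @ g x)"
proof -
  have "computable (\<lambda>x. fold (\<lambda>a s. a # s) (rev (f x)) (g x))"
    by (intro computable_intros assms)
  then show ?thesis by (simp add: fold_Cons_rev)
qed

lemma computable_map [computable_intros]:
  assumes "computable f" "computable (\<lambda>z. g (fst z) (snd z))"
  shows "computable (\<lambda>x. map (g x) (f x))"
proof -
  have "computable (\<lambda>x. rev (fold (\<lambda>a s. g x a # s) (f x) []))"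
    by (intro computable_intros assms computable_comp[OF assms(2), of "\<lambda>z. (fst z, fst (snd z))", simplified])
  moreover have "fold (\<lambda>a s. h a # s) as s = rev (map h as) @ s" for h :: "'b \<Rightarrow> 'c" and as s
    by (induction as arbitrary: s) simp_all
  ultimately show ?thesis by simp
qed

lemma computable_concat [computable_intros]:
  assumes "computable f"
  shows "computable (\<lambda>x. concat (f x))"
proof -
  have "computable (\<lambda>x. fold (\<lambda>a s. s @ a) (f x) [])"
    by (intro computable_intros assms)
  moreover have "fold (\<lambda>a s. s @ a) as s = s @ concat as" for as :: "'b list list" and s
    by (induction as arbitrary: s) simp_all
  ultimately show ?thesis by simp
qed

lemma computable_filter [computable_intros]:
  assumes "computable f" "computable (\<lambda>z. P (fst z) (snd z))"
  shows "computable (\<lambda>x. filter (P x) (f x))"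
proof -
  have "computable (\<lambda>x. concat (map (\<lambda>a. if P x a then [a] else []) (f x)))"
    by (intro computable_intros assms)
  moreover have "concat (map (\<lambda>a. if Q a then [a] else []) as) = filter Q as" for Q :: "'b \<Rightarrow> bool" and as
    by (induction as) simp_all
  ultimately show ?thesis by simp
qed

lemma computable_length [computable_intros]:
  assumes "computable f"
  shows "computable (\<lambda>x. length (f x))"
proof -
  have "computable (\<lambda>x. fold (\<lambda>a s. Suc s) (f x) 0)"
    by (intro computable_intros assms)
  moreover have "fold (\<lambda>a s. Suc s) as s = length as + s" for as :: "'b list" and s
    by (induction as arbitrary: s) simp_all
  ultimately show ?thesis by simp
qed

lemma computable_Ball [computable_intros]:
  assumes "computable f" "computable (\<lambda>z. P (fst z) (snd z))"
  shows "computable (\<lambda>x. \<forall>a\<in>set (f x). P x a)"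
proof -
  have "computable (\<lambda>x. filter (\<lambda>a. \<not> P x a) (f x) = [])"
    by (intro computable_intros assms)
  then show ?thesis by (simp add: filter_empty_conv)
qed

lemma computable_Bex [computable_intros]:
  assumes "computable f" "computable (\<lambda>z. P (fst z) (snd z))"
  shows "computable (\<lambda>x. \<exists>a\<in>set (f x). P x a)"
proof -
  have "computable (\<lambda>x. \<not> (\<forall>a\<in>set (f x). \<not> P x a))"
    by (intro computable_intros assms)
  then show ?thesis by simp
qed

lemma computable_member [computable_intros]:
  assumes "computable f" "computable g"
  shows "computable (\<lambda>x. g x \<in> set (f x))"
proof -
  have "computable (\<lambda>x. \<exists>a\<in>set (f x). a = g x)"
    by (intro computable_intros assms computable_comp[OF assms(2)])
  then show ?thesis by simp
qed

lemma computable_subseqs [computable_intros]: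
  assumes "computable f"
  shows "computable (\<lambda>x. subseqs (f x))"
proof -
  have "computable (\<lambda>x. fold (\<lambda>a s. map (\<lambda>as. a # as) s @ s) (rev (f x)) [[]])"
    by (intro computable_intros assms)
  moreover have "fold (\<lambda>a s. map (\<lambda>as. a # as) s @ s) (rev as) [[]] = subseqs as" for as :: "'b list"
    by (induction as) (simp_all add: Let_def)
  ultimately show ?thesis by simp
qed


section \<open>Standardization and patterns\<close>

lemma length_std [simp]: "length (std xs) = length xs"
  by (simp add: std_def)

lemma std_Nil [simp]: "std [] = []"
  by (simp add: std_def)

lemma std_singleton [simp]: "std [x] = [1]"
proof -
  have "{y. y = x \<and> y \<le> x} = {x}" by auto
  then show ?thesis by (simp add: std_def)
qed

lemma is_perm_distinct: "is_perm w \<Longrightarrow> distinct w"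
  by (simp add: is_perm_def)

text \<open>Standardization as a strictly increasing relabelling. In this form it commutes with
  concatenation and with taking subsequences.\<close>

lemma std_eq_map:
  obtains r where "std xs = map r xs" "strict_mono_on (set xs) r"
proof
  show "std xs = map (\<lambda>x. card {y \<in> set xs. y \<le> x}) xs" by (simp add: std_def)
  show "strict_mono_on (set xs) (\<lambda>x. card {y \<in> set xs. y \<le> x})"
    by (rule strict_mono_onI) (simp add: rank_less_iff)
qed

lemma std_map:
  fixes f :: "nat \<Rightarrow> nat"
  assumes f: "strict_mono_on (set xs) f" and "distinct xs"
  shows "std (map f xs) = std xs"
proof (rule std_cong)
  show "order_iso (map f xs) xs"
    using f by (auto simp: order_iso_def strict_mono_on_less)
  show "distinct (map f xs)"
    using assms strict_mono_on_imp_inj_on[OF f] by (simp add: distinct_map)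
qed fact

lemma subseq_distinct: "subseq t s \<Longrightarrow> distinct s \<Longrightarrow> distinct t"
  by (auto simp: subseq_conv_nths)

lemma subseq_set_subset: "subseq t s \<Longrightarrow> set t \<subseteq> set s"
  by (auto simp: subseq_conv_nths dest: in_set_nthsD)

text \<open>Index sets are traded for subsequences, which can be cut along concatenations. Indices
  beyond the word select nothing, so the bound on the index set can be imposed afterwards by
  intersecting.\<close>

lemma is_pattern_iff: "is_pattern \<gamma> s \<longleftrightarrow> (\<exists>t. subseq t s \<and> std t = \<gamma>)"
proof
  assume "is_pattern \<gamma> s"
  then show "\<exists>t. subseq t s \<and> std t = \<gamma>"
    by (auto simp: is_pattern_def subperm_def subseq_conv_nths)
next
  assume "\<exists>t. subseq t s \<and> std t = \<gamma>"
  then obtain N where N: "std (nths s N) = \<gamma>" by (auto simp: subseq_conv_nths)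
  have "nths s (N \<inter> {..<length s}) = nths s N"
    unfolding nths_def
    by (rule arg_cong[where f = "map fst"], rule filter_cong) (auto simp: set_zip)
  with N show "is_pattern \<gamma> s"
    unfolding is_pattern_def subperm_def by (intro exI[of _ "N \<inter> {..<length s}"]) simp
qed

lemma is_pattern_refl: "is_perm w \<Longrightarrow> is_pattern w w"
  using std_perm by (auto simp: is_pattern_iff)

lemma is_pattern_Nil: "is_pattern [] s"
  unfolding is_pattern_iff by (rule exI[of _ "[]"]) simp

lemma is_pattern_singleton:
  assumes "s \<noteq> []"
  shows "is_pattern [1] s"
proof -
  have "subseq [hd s] s" using assms by (cases s) simp_all
  then show ?thesis unfolding is_pattern_iff using std_singleton by blast
qed

lemma is_pattern_length: "is_pattern \<gamma> s \<Longrightarrow> length \<gamma> \<le> length s"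
  by (auto simp: is_pattern_iff dest: list_emb_length)

text \<open>Subsequences of the relabelled word are the relabelled subsequences, and an increasing
  relabelling does not change their standardization.\<close>

lemma is_pattern_std_iff:
  assumes "distinct s"
  shows "is_pattern \<gamma> (std s) \<longleftrightarrow> is_pattern \<gamma> s"
proof -
  obtain r where r: "std s = map r s" "strict_mono_on (set s) r" by (rule std_eq_map)
  have std: "std (map r t) = std t" if "subseq t s" for t
    using that assms r(2)
    by (intro std_map subseq_distinct[of t s]) (auto intro: monotone_on_subset dest: subseq_set_subset)
  have "is_pattern \<gamma> (map r s) \<longleftrightarrow> (\<exists>N. std (map r (nths s N)) = \<gamma>)"
    by (auto simp: is_pattern_iff subseq_conv_nths nths_map)
  also have "\<dots> \<longleftrightarrow> (\<exists>N. std (nths s N) = \<gamma>)"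
    using std[unfolded subseq_conv_nths] by metis
  finally show ?thesis by (auto simp: r(1) is_pattern_iff subseq_conv_nths)
qed

lemma is_pattern_trans:
  assumes "is_pattern a b" "is_pattern b c" "distinct c"
  shows "is_pattern a c"
proof -
  obtain t where t: "subseq t c" "b = std t" using assms(2) by (auto simp: is_pattern_iff)
  then have "is_pattern a t" using assms is_pattern_std_iff[of t a] subseq_distinct by blast
  then show ?thesis using t(1) unfolding is_pattern_iff by (blast intro: subseq_order.trans)
qed

lemma subseq_concatD:
  "subseq t (concat ws) \<Longrightarrow> \<exists>ts. concat ts = t \<and> list_all2 subseq ts ws"
proof (induction ws arbitrary: t)
  case Nil
  then show ?case by (intro exI[of _ "[]"]) (simp, metis list_emb_Nil2)
next
  case (Cons w ws)
  then obtain t1 t2 where "t = t1 @ t2" "subseq t1 w" "subseq t2 (concat ws)"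
    by (auto elim: subseq_appendE)
  moreover from this Cons.IH obtain ts where "concat ts = t2" "list_all2 subseq ts ws" by blast
  ultimately show ?case by (intro exI[of _ "t1 # ts"]) simp
qed

lemma subseq_concatI: "list_all2 subseq ts ws \<Longrightarrow> subseq (concat ts) (concat ws)"
  by (induction rule: list_all2_induct) (simp_all add: list_emb_append_mono)

lemma in_set_concat_nth: "x \<in> set (concat vs) \<longleftrightarrow> (\<exists>i<length vs. x \<in> set (vs ! i))"
  by (auto simp: set_conv_nth[of vs])

lemma distinct_concat_nth: "distinct (concat ws) \<Longrightarrow> i < length ws \<Longrightarrow> distinct (ws ! i)"
  by (induction ws arbitrary: i) (auto simp: nth_Cons split: nat.split)


section \<open>Substitution\<close>

text \<open>The blocks \<open>vs\<close> are arranged by value like the entries of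
  \<open>\<pi>\<close>. Empty blocks satisfy this vacuously, and \<open>\<pi>\<close> may be any
  word. Quantifying over the zipped list instead of indices gives a form that list operations decide
  directly.\<close>

definition compatible :: "nat list \<Rightarrow> nat list list \<Rightarrow> bool" where
  "compatible \<pi> vs \<longleftrightarrow> (\<forall>a\<in>set (zip \<pi> vs). \<forall>b\<in>set (zip \<pi> vs).
     fst a < fst b \<longrightarrow> (\<forall>x\<in>set (snd a). \<forall>y\<in>set (snd b). x < y))"

lemma compatible_nth:
  "length vs = length \<pi> \<Longrightarrow> compatible \<pi> vs \<longleftrightarrow>
     (\<forall>i<length \<pi>. \<forall>j<length \<pi>. \<pi> ! i < \<pi> ! j \<longrightarrow> (\<forall>x\<in>set (vs ! i). \<forall>y\<in>set (vs ! j). x < y))"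
  unfolding compatible_def set_zip by (simp add: Ball_def) blast

lemma compatible_map:
  assumes "strict_mono_on (set \<pi>) r" "compatible \<pi> vs"
  shows "compatible (map r \<pi>) vs"
  unfolding compatible_def
proof (intro ballI impI)
  fix a b x y
  assume *: "a \<in> set (zip (map r \<pi>) vs)" "b \<in> set (zip (map r \<pi>) vs)" "fst a < fst b"
    "x \<in> set (snd a)" "y \<in> set (snd b)"
  then obtain p q where pq: "(p, snd a) \<in> set (zip \<pi> vs)" "(q, snd b) \<in> set (zip \<pi> vs)"
    "fst a = r p" "fst b = r q"
    by (auto simp: zip_map1)
  then have "p \<in> set \<pi>" "q \<in> set \<pi>" by (auto dest: set_zip_leftD)
  then have "p < q" using pq *(3) assms(1) by (simp add: strict_mono_on_less)
  with pq * assms(2) show "x < y" unfolding compatible_def by fastforce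
qed

lemma compatible_disjoint:
  assumes "compatible \<pi> vs" "length vs = length \<pi>" "distinct \<pi>"
    "i < length \<pi>" "j < length \<pi>" "i \<noteq> j"
  shows "set (vs ! i) \<inter> set (vs ! j) = {}"
proof -
  have "\<pi> ! i \<noteq> \<pi> ! j" using assms by (simp add: nth_eq_iff_index_eq)
  then show ?thesis using assms(1,2,4,5) compatible_nth[of vs \<pi>]
    by (metis disjoint_iff linorder_neqE_nat less_asym)
qed

lemma distinct_concatI:
  assumes "\<And>i. i < length ws \<Longrightarrow> distinct (ws ! i)"
    and "\<And>i j. i < length ws \<Longrightarrow> j < length ws \<Longrightarrow> i \<noteq> j \<Longrightarrow> set (ws ! i) \<inter> set (ws ! j) = {}"
  shows "distinct (concat ws)"
  using assms
proof (induction ws)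
  case (Cons w ws)
  have "distinct (concat ws)"
    using Cons.prems(1)[of "Suc _"] Cons.prems(2)[of "Suc _" "Suc _"] by (intro Cons.IH) auto
  moreover have "distinct w" using Cons.prems(1)[of 0] by simp
  moreover have "set w \<inter> set (ws ! i) = {}" if "i < length ws" for i
    using Cons.prems(2)[of 0 "Suc i"] that by simp
  then have "set w \<inter> set (concat ws) = {}" by (force simp: in_set_conv_nth)
  ultimately show ?case by simp
qed simp

text \<open>In a permutation an entry \<open>x\<close> is the number of entries up to
  \<open>x\<close>. For \<open>x\<close> in block \<open>i\<close> these are the entries of the
  block up to \<open>x\<close>, which give its rank there, and all entries of the blocks
  \<open>j\<close> with \<open>\<pi> ! j < \<pi> ! i\<close>, which give the shift in
  \<open>inflate\<close>.\<close>

lemma concat_eq_inflate: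
  assumes \<pi>: "distinct \<pi>" and len: "length vs = length \<pi>" and comp: "compatible \<pi> vs"
    and perm: "is_perm (concat vs)"
  shows "concat vs = inflate \<pi> (map std vs)"
proof -
  let ?n = "length \<pi>"
  let ?L = "\<lambda>i. {j \<in> {..<?n}. \<pi> ! j < \<pi> ! i}"
  have dist: "distinct (vs ! i)" if "i < ?n" for i
    using perm that len by (simp add: is_perm_def distinct_concat_nth)
  have rank: "card {y \<in> set (vs ! i). y \<le> x} + (\<Sum>j\<in>?L i. length (vs ! j)) = x"
    if i: "i < ?n" and x: "x \<in> set (vs ! i)" for i x
  proof -
    have sub: "set (vs ! j) \<subseteq> {1..length (concat vs)}" if "j < ?n" for j
      using perm that len unfolding is_perm_def by (metis UN_upper nth_mem set_concat)
    have "{y \<in> set (concat vs). y \<le> x} = {y \<in> set (vs ! i). y \<le> x} \<union> (\<Union>j\<in>?L i. set (vs ! j))"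
    proof (intro set_eqI iffI)
      fix y assume y: "y \<in> {y \<in> set (concat vs). y \<le> x}"
      then obtain j where j: "j < ?n" "y \<in> set (vs ! j)"
        using len unfolding mem_Collect_eq in_set_concat_nth by auto
      have "\<pi> ! j = \<pi> ! i \<Longrightarrow> j = i" using \<pi> i j by (simp add: nth_eq_iff_index_eq)
      moreover have "\<not> \<pi> ! i < \<pi> ! j" using comp i j x y unfolding compatible_nth[OF len] mem_Collect_eq by (meson leD)
      ultimately have "j = i \<or> j \<in> ?L i" using j(1) by auto
      then show "y \<in> {y \<in> set (vs ! i). y \<le> x} \<union> (\<Union>j\<in>?L i. set (vs ! j))"
        using j(2) y by blast
    next
      fix y assume "y \<in> {y \<in> set (vs ! i). y \<le> x} \<union> (\<Union>j\<in>?L i. set (vs ! j))"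
      then obtain j where j: "j < ?n" "y \<in> set (vs ! j)" "y \<le> x \<or> \<pi> ! j < \<pi> ! i"
        using i by auto
      then have "y \<le> x" using comp i x unfolding compatible_nth[OF len] by (meson less_imp_le)
      moreover have "y \<in> set (concat vs)" using j len unfolding in_set_concat_nth by auto
      ultimately show "y \<in> {y \<in> set (concat vs). y \<le> x}" by simp
    qed
    moreover have "{y \<in> set (concat vs). y \<le> x} = {1..x}"
      using perm sub[OF i] x unfolding is_perm_def by auto
    ultimately have "x = card ({y \<in> set (vs ! i). y \<le> x} \<union> (\<Union>j\<in>?L i. set (vs ! j)))"
      by (metis card_atLeastAtMost diff_Suc_1)
    also have "\<dots> = card {y \<in> set (vs ! i). y \<le> x} + card (\<Union>j\<in>?L i. set (vs ! j))"
    proof (rule card_Un_disjoint)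
      have "set (vs ! i) \<inter> set (vs ! j) = {}" if "j \<in> ?L i" for j
        using that by (intro compatible_disjoint[OF comp len \<pi> i]) auto
      then show "{y \<in> set (vs ! i). y \<le> x} \<inter> (\<Union>j\<in>?L i. set (vs ! j)) = {}" by blast
    qed simp_all
    also have "card (\<Union>j\<in>?L i. set (vs ! j)) = (\<Sum>j\<in>?L i. card (set (vs ! j)))"
      using compatible_disjoint[OF comp len \<pi>] by (intro card_UN_disjoint) auto
    also have "\<dots> = (\<Sum>j\<in>?L i. length (vs ! j))"
      using dist by (intro sum.cong) (auto simp: distinct_card)
    finally show ?thesis by simp
  qed
  have "map (\<lambda>i. map (\<lambda>x. x + (\<Sum>j\<in>?L i. length (map std vs ! j))) (map std vs ! i)) [0..<?n] = vs"
  proof (rule nth_equalityI)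
    fix i assume "i < length (map (\<lambda>i. map (\<lambda>x. x + (\<Sum>j\<in>?L i. length (map std vs ! j))) (map std vs ! i)) [0..<?n])"
    then have i: "i < ?n" by simp
    have "(\<Sum>j\<in>?L i. length (map std vs ! j)) = (\<Sum>j\<in>?L i. length (vs ! j))"
      using len by (intro sum.cong) auto
    then show "map (\<lambda>i. map (\<lambda>x. x + (\<Sum>j\<in>?L i. length (map std vs ! j))) (map std vs ! i)) [0..<?n] ! i = vs ! i"
      using i len rank[OF i] by (simp add: std_def map_idI)
  qed (simp add: len)
  then show ?thesis unfolding inflate_def by simp
qed

text \<open>Exhibits the shifted blocks of a substitution as segments of the word, so that
  subsequences can be cut along them.\<close>

lemma inflate_split:
  assumes \<pi>: "is_perm \<pi>" and len: "length \<sigma>s = length \<pi>" and \<sigma>s: "\<forall>\<sigma>\<in>set \<sigma>s. is_perm \<sigma>"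
  obtains ws where "inflate \<pi> \<sigma>s = concat ws" "length ws = length \<pi>" "compatible \<pi> ws"
    "map std ws = \<sigma>s" "is_perm (concat ws)"
proof
  let ?n = "length \<pi>"
  let ?L = "\<lambda>i. {j \<in> {..<?n}. \<pi> ! j < \<pi> ! i}"
  let ?S = "\<lambda>i. (\<Sum>j\<in>?L i. length (\<sigma>s ! j))"
  define ws where "ws = map (\<lambda>i. map (\<lambda>x. x + ?S i) (\<sigma>s ! i)) [0..<?n]"
  have len_ws: "length ws = ?n" by (simp add: ws_def)
  have nth: "ws ! i = map (\<lambda>x. x + ?S i) (\<sigma>s ! i)" if "i < ?n" for i
    using that by (simp add: ws_def)
  have perm: "distinct (\<sigma>s ! i)" "set (\<sigma>s ! i) = {1..length (\<sigma>s ! i)}" if "i < ?n" for i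
    using \<sigma>s that len by (auto simp: is_perm_def)
  show "inflate \<pi> \<sigma>s = concat ws" by (simp add: inflate_def ws_def)
  show "length ws = length \<pi>" by fact
  \<comment> \<open>Used for two index sets \<open>J\<close>: the blocks below block
    \<open>j\<close>, to separate blocks by value, and all blocks, to bound the entries by the total
    size.\<close>
  have bound: "?S i + length (\<sigma>s ! i) \<le> (\<Sum>j\<in>J. length (\<sigma>s ! j))"
    if "i < ?n" "finite J" "insert i (?L i) \<subseteq> J" for i J
  proof -
    have "?S i + length (\<sigma>s ! i) = (\<Sum>j\<in>insert i (?L i). length (\<sigma>s ! j))" by simp
    also have "\<dots> \<le> (\<Sum>j\<in>J. length (\<sigma>s ! j))" using that by (intro sum_mono2) auto
    finally show ?thesis .
  qed
  show comp: "compatible \<pi> ws"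
    unfolding compatible_nth[OF len_ws]
  proof (intro allI impI ballI)
    fix i j x y
    assume *: "i < ?n" "j < ?n" "\<pi> ! i < \<pi> ! j" "x \<in> set (ws ! i)" "y \<in> set (ws ! j)"
    have "x \<le> ?S i + length (\<sigma>s ! i)" using * nth perm by auto
    also have "\<dots> \<le> ?S j" using * by (intro bound) auto
    also have "\<dots> < y" using * nth perm by auto
    finally show "x < y" .
  qed
  show "map std ws = \<sigma>s"
  proof (rule nth_equalityI)
    fix i assume "i < length (map std ws)"
    then have i: "i < ?n" by (simp add: len_ws)
    have "std (ws ! i) = std (\<sigma>s ! i)"
      unfolding nth[OF i] using perm[OF i] by (intro std_map) (auto simp: strict_mono_on_def)
    then show "map std ws ! i = \<sigma>s ! i" using i \<sigma>s len by (simp add: len_ws std_perm)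
  qed (simp add: len_ws len)
  have "distinct (concat ws)"
  proof (rule distinct_concatI)
    fix i assume "i < length ws"
    then show "distinct (ws ! i)" using nth perm by (simp add: len_ws distinct_map inj_on_def)
  next
    fix i j assume "i < length ws" "j < length ws" "i \<noteq> j"
    then show "set (ws ! i) \<inter> set (ws ! j) = {}"
      using compatible_disjoint[OF comp len_ws is_perm_distinct[OF \<pi>]] by (simp add: len_ws)
  qed
  moreover have "length (concat ws) = (\<Sum>j<?n. length (\<sigma>s ! j))"
    by (simp add: ws_def length_concat o_def interv_sum_list_conv_sum_set_nat atLeast0LessThan)
  then have "set (concat ws) \<subseteq> {1..length (concat ws)}"
  proof (intro subsetI)
    fix x assume len': "length (concat ws) = (\<Sum>j<?n. length (\<sigma>s ! j))" and "x \<in> set (concat ws)"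
    then obtain i where i: "i < ?n" "x \<in> set (ws ! i)" using len_ws unfolding in_set_concat_nth by auto
    then have "x \<le> ?S i + length (\<sigma>s ! i)" "1 \<le> x" using nth perm by auto
    moreover have "?S i + length (\<sigma>s ! i) \<le> (\<Sum>j<?n. length (\<sigma>s ! j))"
      using i by (intro bound) auto
    ultimately show "x \<in> {1..length (concat ws)}" using len' by simp
  qed
  ultimately show "is_perm (concat ws)"
    unfolding is_perm_def by (metis card_atLeastAtMost card_subset_eq diff_Suc_1 distinct_card finite_atLeastAtMost)
qed

text \<open>
  The pieces \<open>vs\<close> may be empty: an occurrence of \<open>\<beta>\<close> need not meet every block of the
  substitution.
\<close>

lemma is_pattern_inflate_iff:
  assumes \<pi>: "is_perm \<pi>" and len: "length \<sigma>s = length \<pi>" and \<sigma>s: "\<forall>\<sigma>\<in>set \<sigma>s. is_perm \<sigma>"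
    and \<beta>: "is_perm \<beta>"
  shows "is_pattern \<beta> (inflate \<pi> \<sigma>s) \<longleftrightarrow> (\<exists>vs. length vs = length \<pi> \<and> concat vs = \<beta> \<and>
    compatible \<pi> vs \<and> (\<forall>i<length \<pi>. is_pattern (std (vs ! i)) (\<sigma>s ! i)))" (is "_ \<longleftrightarrow> ?R")
proof -
  obtain ws where ws: "inflate \<pi> \<sigma>s = concat ws" "length ws = length \<pi>" "compatible \<pi> ws"
    "map std ws = \<sigma>s" "is_perm (concat ws)"
    using inflate_split[OF \<pi> len \<sigma>s] by blast
  have dist_ws: "distinct (ws ! i)" if "i < length \<pi>" for i
    using ws(2,5) that by (simp add: is_perm_def distinct_concat_nth)
  have \<sigma>i: "\<sigma>s ! i = std (ws ! i)" if "i < length \<pi>" for i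
    using ws(2,4) that by auto
  have comp: "compatible \<pi> ts" "compatible \<pi> (map (map r) ts)"
    if ts: "list_all2 subseq ts ws" "strict_mono_on (set (concat ts)) r" for ts and r :: "nat \<Rightarrow> nat"
  proof -
    have len_ts: "length ts = length \<pi>" using ts ws(2) by (simp add: list_all2_lengthD)
    have sub: "set (ts ! i) \<subseteq> set (ws ! i)" if "i < length \<pi>" for i
      using ts that len_ts by (simp add: list_all2_nthD subseq_set_subset)
    show c: "compatible \<pi> ts"
      using ws(3) sub unfolding compatible_nth[OF len_ts] compatible_nth[OF ws(2)] by blast
    have "r x < r y"
      if "i < length \<pi>" "j < length \<pi>" "\<pi> ! i < \<pi> ! j" "x \<in> set (ts ! i)" "y \<in> set (ts ! j)" for i j x y
    proof -
      have "x < y" using c that unfolding compatible_nth[OF len_ts] by blast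
      moreover have "x \<in> set (concat ts)" "y \<in> set (concat ts)"
        using that len_ts unfolding in_set_concat_nth by auto
      ultimately show ?thesis using ts(2) by (simp add: strict_mono_onD)
    qed
    then show "compatible \<pi> (map (map r) ts)"
      using len_ts by (subst compatible_nth) auto
  qed
  have std_r: "std (map r (ts ! i)) = std (ts ! i)"
    if "list_all2 subseq ts ws" "strict_mono_on (set (concat ts)) r" "i < length \<pi>"
    for ts i and r :: "nat \<Rightarrow> nat"
  proof (rule std_map)
    have i: "i < length ts" using that ws(2) by (simp add: list_all2_lengthD)
    then show "distinct (ts ! i)"
      using that dist_ws subseq_distinct by (metis list_all2_nthD)
    have "set (ts ! i) \<subseteq> set (concat ts)" using in_set_concat_nth[of _ ts] i by blast
    then show "strict_mono_on (set (ts ! i)) r" using that(2) monotone_on_subset by blast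
  qed
  show ?thesis
  proof
    assume "is_pattern \<beta> (inflate \<pi> \<sigma>s)"
    \<comment> \<open>An occurrence is cut along the blocks; relabelling the cuts by the
      standardizing map \<open>r\<close> gives the required splitting of
      \<open>\<beta>\<close>.\<close>
    then obtain ts where ts: "std (concat ts) = \<beta>" "list_all2 subseq ts ws"
      by (metis is_pattern_iff subseq_concatD ws(1))
    obtain r where r: "std (concat ts) = map r (concat ts)" "strict_mono_on (set (concat ts)) r"
      by (rule std_eq_map)
    have len_ts: "length ts = length \<pi>" using ts ws(2) by (simp add: list_all2_lengthD)
    have "is_pattern (std (map r (ts ! i))) (\<sigma>s ! i)" if i: "i < length \<pi>" for i
    proof -
      have "subseq (ts ! i) (ws ! i)" using ts i len_ts by (simp add: list_all2_nthD)
      then have "is_pattern (std (ts ! i)) (ws ! i)" by (auto simp: is_pattern_iff)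
      then show ?thesis
        using std_r[OF ts(2) r(2) i] \<sigma>i[OF i] is_pattern_std_iff[OF dist_ws[OF i]] by simp
    qed
    then show ?R
      using comp(2)[OF ts(2) r(2)] r(1) ts(1) len_ts
      by (intro exI[of _ "map (map r) ts"]) (simp add: map_concat)
  next
    assume ?R
    then obtain vs where vs: "length vs = length \<pi>" "concat vs = \<beta>" "compatible \<pi> vs"
      and pat: "\<And>i. i < length \<pi> \<Longrightarrow> is_pattern (std (vs ! i)) (\<sigma>s ! i)" by blast
    have "\<exists>t. subseq t (ws ! i) \<and> std t = std (vs ! i)" if "i < length \<pi>" for i
      using pat[OF that] \<sigma>i[OF that] is_pattern_std_iff[OF dist_ws[OF that]]
      by (auto simp: is_pattern_iff)
    \<comment> \<open>An occurrence of each piece is chosen inside its block. Joined together they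
      form an occurrence of \<open>\<beta>\<close>, because both standardize to the inflation of
      \<open>\<pi>\<close> by the same standardized pieces.\<close>
    then obtain t where t: "\<And>i. i < length \<pi> \<Longrightarrow> subseq (t i) (ws ! i)"
      "\<And>i. i < length \<pi> \<Longrightarrow> std (t i) = std (vs ! i)"
      by metis
    define ts where "ts = map t [0..<length \<pi>]"
    have len_ts: "length ts = length \<pi>" by (simp add: ts_def)
    have ts: "list_all2 subseq ts ws" using t(1) ws(2) by (simp add: ts_def list_all2_conv_all_nth)
    have std_ts: "map std ts = map std vs"
      by (rule nth_equalityI) (simp_all add: ts_def vs(1) t(2))
    have sub: "subseq (concat ts) (concat ws)" by (rule subseq_concatI[OF ts])
    obtain r where r: "std (concat ts) = map r (concat ts)" "strict_mono_on (set (concat ts)) r"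
      by (rule std_eq_map)
    have cc: "concat (map (map r) ts) = std (concat ts)" by (simp add: r(1) map_concat)
    have "std (concat ts) = inflate \<pi> (map std (map (map r) ts))"
      unfolding cc[symmetric]
    proof (rule concat_eq_inflate)
      show "is_perm (concat (map (map r) ts))"
        unfolding cc by (rule is_perm_std) (rule subseq_distinct[OF sub is_perm_distinct[OF ws(5)]])
    qed (use comp(2)[OF ts r(2)] \<pi> in \<open>simp_all add: len_ts is_perm_distinct\<close>)
    also have "map std (map (map r) ts) = map std ts"
      by (rule nth_equalityI) (simp_all add: len_ts std_r[OF ts r(2)])
    also have "inflate \<pi> (map std ts) = \<beta>"
      using concat_eq_inflate[OF is_perm_distinct[OF \<pi>] vs(1,3)] vs(2) \<beta> std_ts by simp
    finally show "is_pattern \<beta> (inflate \<pi> \<sigma>s)" using sub ws(1) by (auto simp: is_pattern_iff)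
  qed
qed

lemma compatible_singletons: "compatible \<pi> (map (\<lambda>x. [x]) \<pi>)"
  by (auto simp: compatible_nth)

lemma concat_singletons [simp]: "concat (map (\<lambda>x. [x]) xs) = xs"
  by (induction xs) simp_all

lemma inflate_singletons:
  assumes "is_perm \<pi>"
  shows "inflate \<pi> (replicate (length \<pi>) [1]) = \<pi>"
proof -
  have "map (\<lambda>x. [1::nat]) \<pi> = replicate (length \<pi>) [1]" by (simp add: map_replicate_const)
  then show ?thesis
    using concat_eq_inflate[OF is_perm_distinct[OF assms] _ compatible_singletons] assms
    by (simp add: o_def)
qed

lemma is_perm_inflate:
  assumes "is_perm \<pi>" "length \<sigma>s = length \<pi>" "\<forall>\<sigma>\<in>set \<sigma>s. is_perm \<sigma>"
  shows "is_perm (inflate \<pi> \<sigma>s)"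
proof -
  obtain ws where "inflate \<pi> \<sigma>s = concat ws" "is_perm (concat ws)"
    using inflate_split[OF assms] by blast
  then show ?thesis by simp
qed

lemma inflate_ne_Nil:
  assumes "is_perm \<pi>" "length \<sigma>s = length \<pi>" "\<forall>\<sigma>\<in>set \<sigma>s. is_perm \<sigma> \<and> \<sigma> \<noteq> []" "\<pi> \<noteq> []"
  shows "inflate \<pi> \<sigma>s \<noteq> []"
proof -
  obtain ws where ws: "inflate \<pi> \<sigma>s = concat ws" "length ws = length \<pi>" "map std ws = \<sigma>s"
    using inflate_split[of \<pi> \<sigma>s] assms by blast
  have "std (hd ws) \<in> set \<sigma>s" using ws assms(4) by (cases ws) auto
  then have "hd ws \<noteq> []" using assms(3) by auto
  then show ?thesis using ws assms(4) by (cases ws) auto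
qed


section \<open>Intervals\<close>

text \<open>Each outer entry lies below all of \<open>v\<close> or below none of it. For a nonempty
  segment \<open>v\<close> of a permutation \<open>u @ v @ z\<close> this says that \<open>v\<close>
  occupies an interval, but the condition survives increasing relabelling and makes sense for words
  with gaps in their values.\<close>

definition homogeneous :: "nat list \<Rightarrow> nat list \<Rightarrow> nat list \<Rightarrow> bool" where
  "homogeneous u v z \<longleftrightarrow> (\<forall>c\<in>set (u @ z). \<forall>x\<in>set v. \<forall>y\<in>set v. c < x \<longrightarrow> c < y)"

lemma image_nth_middle:
  "(!) (u @ v @ z) ` {length u..<length u + length v} = set v"
proof -
  have "(!) (u @ v @ z) ` {length u..<length u + length v} = (!) (u @ v @ z) ` (\<lambda>i. length u + i) ` {..<length v}"
    by (simp add: lessThan_atLeast0 add.commute)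
  also have "\<dots> = (!) v ` {..<length v}"
    unfolding image_image by (intro image_cong) (simp_all add: nth_append)
  also have "\<dots> = set v" by (auto simp: set_conv_nth)
  finally show ?thesis .
qed

lemma nths_middle: "nths (u @ v @ z) {length u..<length u + length v} = v"
proof -
  have "nths u {length u..<length u + length v} = []" by (auto simp: nths_def filter_empty_conv set_zip)
  moreover have "nths v {j. j + length u \<in> {length u..<length u + length v}} = v"
    by (rule nths_all) simp
  moreover have "nths z {j. j + length v \<in> {j. j + length u \<in> {length u..<length u + length v}}} = []"
    by (auto simp: nths_def filter_empty_conv set_zip)
  ultimately show ?thesis by (simp add: nths_append)
qed

text \<open>A value strictly between the minimum and the maximum of \<open>v\<close> but outside
  \<open>v\<close> would lie below the maximum and not below the minimum, against
  homogeneity.\<close>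

lemma is_interval_middle:
  assumes perm: "is_perm (u @ v @ z)" and hom: "homogeneous u v z" and v: "v \<noteq> []"
  shows "is_interval (u @ v @ z) {length u..<length u + length v}"
proof -
  let ?a = "Min (set v)" and ?b = "Max (set v)"
  have ab: "?a \<in> set v" "?b \<in> set v" using v by simp_all
  have "set v = {?a..<Suc ?b}"
  proof (intro equalityI subsetI)
    fix c assume c: "c \<in> {?a..<Suc ?b}"
    have "?a \<in> {1..length (u @ v @ z)}" "?b \<in> {1..length (u @ v @ z)}"
      using ab perm unfolding is_perm_def by auto
    then have "c \<in> {1..length (u @ v @ z)}" using c by simp
    then have "c \<in> set (u @ v @ z)" using perm unfolding is_perm_def by blast
    show "c \<in> set v"
    proof (rule ccontr)
      assume nc: "c \<notin> set v"
      then have "c \<in> set (u @ z)" using \<open>c \<in> set (u @ v @ z)\<close> by auto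
      moreover have "c \<noteq> ?a" "c \<noteq> ?b" using nc ab by auto
      ultimately show False using hom ab c unfolding homogeneous_def
        by (metis atLeastLessThan_iff le_neq_implies_less less_Suc_eq_le leD)
    qed
  qed (auto simp: less_Suc_eq_le)
  then show ?thesis
    using v unfolding is_interval_def image_nth_middle by auto
qed

lemma is_interval_split:
  assumes perm: "is_perm w" and I: "is_interval w I"
  obtains u v z where "w = u @ v @ z" "homogeneous u v z" "I = {length u..<length u + length v}"
proof -
  obtain i j a b where ij: "I = {i..<j}" and ab: "(!) w ` I = {a..<b}" and ne: "I \<noteq> {}"
    and sub: "I \<subseteq> {..<length w}"
    using I unfolding is_interval_def by blast
  have lt: "i < j" using ne ij by simp
  then have "j - 1 \<in> {..<length w}" using sub ij by (intro subsetD[OF sub]) auto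
  then have le: "j \<le> length w" using lt by auto
  define u v z where "u = take i w" and "v = take (j - i) (drop i w)" and "z = drop j w"
  have "v @ z = drop i w"
    using lt le unfolding v_def z_def
    by (metis add_diff_inverse_nat append_take_drop_id drop_drop less_imp_le_nat not_less add.commute)
  then have w: "w = u @ v @ z" by (simp add: u_def)
  have I': "I = {length u..<length u + length v}" using lt le by (simp add: u_def v_def ij)
  have "set v = {a..<b}" using ab image_nth_middle[of u v z] w I' by simp
  moreover have "set (u @ z) \<inter> set v = {}" using is_perm_distinct[OF perm] w by auto
  ultimately have "homogeneous u v z" unfolding homogeneous_def by fastforce
  then show ?thesis using that w I' by blast
qed

text \<open>Labels are distinct, so every other block lies entirely below or entirely above block
  \<open>i\<close>.\<close>

lemma compatible_homogeneous:
  assumes \<pi>: "distinct \<pi>" and len: "length vs = length \<pi>" and comp: "compatible \<pi> vs"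
    and i: "i < length \<pi>"
  obtains u z where "concat vs = u @ vs ! i @ z" "homogeneous u (vs ! i) z"
proof
  show "concat vs = concat (take i vs) @ vs ! i @ concat (drop (Suc i) vs)"
    using i len by (subst id_take_nth_drop[of i vs]) simp_all
  show "homogeneous (concat (take i vs)) (vs ! i) (concat (drop (Suc i) vs))"
    unfolding homogeneous_def
  proof (intro ballI impI)
    fix c x y
    assume c: "c \<in> set (concat (take i vs) @ concat (drop (Suc i) vs))"
      and xy: "x \<in> set (vs ! i)" "y \<in> set (vs ! i)" "c < x"
    obtain j where j: "j < length \<pi>" "j \<noteq> i" "c \<in> set (vs ! j)"
    proof -
      have "\<exists>v\<in>set (take i vs) \<union> set (drop (Suc i) vs). c \<in> set v" using c by auto
      then obtain v where v: "v \<in> set (take i vs) \<union> set (drop (Suc i) vs)" "c \<in> set v" by blast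
      then obtain j where "j < length vs" "j \<noteq> i" "v = vs ! j"
      proof -
        from v(1) consider k where "k < i" "v = vs ! k" | k where "k < length vs - Suc i" "v = vs ! (Suc i + k)"
          using len i by (auto simp: in_set_conv_nth)
        then show thesis
        proof cases
          case (1 k)
          then show thesis using that[of k] len i by simp
        next
          case (2 k)
          then show thesis using that[of "Suc i + k"] by simp
        qed
      qed
      then show ?thesis using that v(2) len by auto
    qed
    then have "\<pi> ! j \<noteq> \<pi> ! i" using \<pi> i by (simp add: nth_eq_iff_index_eq)
    then show "c < y"
      using comp i j xy unfolding compatible_nth[OF len] by (metis linorder_neqE_nat less_asym)
  qed
qed

text \<open>A piece of \<open>\<beta>\<close> with at least two entries is an interval, hence all of
  \<open>\<beta>\<close>, which then occurs in one component. If every piece has at most one entry,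
  \<open>\<beta>\<close> already occurs in the inflation of \<open>\<pi>\<close> by singletons,
  which is \<open>\<pi>\<close>.\<close>

lemma simple_pattern_inflate:
  assumes \<beta>: "simple_perm \<beta>" and \<pi>: "is_perm \<pi>" and len: "length \<sigma>s = length \<pi>"
    and \<sigma>s: "\<forall>\<sigma>\<in>set \<sigma>s. is_perm \<sigma>" and pat: "is_pattern \<beta> (inflate \<pi> \<sigma>s)"
  shows "is_pattern \<beta> \<pi> \<or> (\<exists>\<sigma>\<in>set \<sigma>s. is_pattern \<beta> \<sigma>)"
proof -
  have perm: "is_perm \<beta>" using \<beta> by (simp add: simple_perm_def)
  obtain vs where vs: "length vs = length \<pi>" "concat vs = \<beta>" "compatible \<pi> vs"
    and p: "\<And>i. i < length \<pi> \<Longrightarrow> is_pattern (std (vs ! i)) (\<sigma>s ! i)"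
    using pat is_pattern_inflate_iff[OF \<pi> len \<sigma>s perm] by blast
  show ?thesis
  proof (cases "\<exists>i<length \<pi>. 1 < length (vs ! i)")
    case True
    then obtain i where i: "i < length \<pi>" "1 < length (vs ! i)" by blast
    obtain u z where uz: "\<beta> = u @ vs ! i @ z" "homogeneous u (vs ! i) z"
      using compatible_homogeneous[OF is_perm_distinct[OF \<pi>] vs(1,3) i(1)] vs(2) by metis
    let ?I = "{length u..<length u + length (vs ! i)}"
    have "is_interval \<beta> ?I"
      using is_interval_middle[of u "vs ! i" z] uz perm i(2) by fastforce
    then have "(\<exists>k. ?I = {k}) \<or> ?I = {..<length \<beta>}" using \<beta> unfolding simple_perm_def by blast
    then have "card ?I = 1 \<or> card ?I = length \<beta>"
      by (metis card_lessThan is_singletonI is_singleton_altdef)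
    then have "vs ! i = \<beta>" using i(2) uz(1) by simp
    then have "is_pattern \<beta> (\<sigma>s ! i)" using p[OF i(1)] std_perm[OF perm] by simp
    then show ?thesis using i(1) len by auto
  next
    case False
    have "is_pattern (std (vs ! i)) [1]" if "i < length \<pi>" for i
    proof -
      have "length (vs ! i) \<le> 1" using False that by auto
      then consider "vs ! i = []" | x where "vs ! i = [x]" by (cases "vs ! i") auto
      then show ?thesis by cases (simp_all add: is_pattern_Nil is_pattern_singleton[simplified])
    qed
    then have "is_pattern \<beta> (inflate \<pi> (replicate (length \<pi>) [1]))"
      using vs by (subst is_pattern_inflate_iff[OF \<pi> _ _ perm]) (auto simp: is_perm_def)
    then show ?thesis unfolding inflate_singletons[OF \<pi>] by blast
  qed
qed


section \<open>Decomposition along a simple permutation\<close>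

lemma exists_homogeneous_split:
  assumes perm: "is_perm \<pi>" and len: "2 \<le> length \<pi>"
    and not: "\<pi> \<noteq> oplus" "\<pi> \<noteq> ominus" "\<not> simple_perm \<pi>"
  obtains u v z where "\<pi> = u @ v @ z" "homogeneous u v z" "1 < length v" "length v < length \<pi>"
proof -
  consider "length \<pi> = 2" | "length \<pi> = 3" | "4 \<le> length \<pi>" using len by linarith
  then show thesis
  proof cases
    case 1
    then obtain a b where "\<pi> = [a, b]" by (auto simp: length_Suc_conv numeral_eq_Suc)
    moreover from this perm have "{a, b} = {1, 2}" "a \<noteq> b"
      by (auto simp: is_perm_def numeral_eq_Suc atLeastAtMostSuc_conv)
    ultimately show thesis using not by (auto simp: doubleton_eq_iff)
  next
    case 2
    then obtain a b c where \<pi>: "\<pi> = [a, b, c]" by (auto simp: length_Suc_conv numeral_eq_Suc)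
    have "distinct \<pi>" by (rule is_perm_distinct[OF perm])
    \<comment> \<open>Among three distinct entries, it cannot happen both that the last separates
      the first two and that the first separates the last two.\<close>
    then have "homogeneous [] [a, b] [c] \<or> homogeneous [a] [b, c] []"
      unfolding \<pi> homogeneous_def by auto
    then show thesis using that[of "[]" "[a, b]" "[c]"] that[of "[a]" "[b, c]" "[]"] \<pi> by auto
  next
    case 3
    then obtain I where I: "is_interval \<pi> I" "\<nexists>i. I = {i}" "I \<noteq> {..<length \<pi>}"
      using not(3) perm unfolding simple_perm_def by blast
    obtain u v z where uvz: "\<pi> = u @ v @ z" "homogeneous u v z" "I = {length u..<length u + length v}"
      by (rule is_interval_split[OF perm I(1)])
    have "v \<noteq> []" using I(1) uvz(3) by (auto simp: is_interval_def)
    moreover have "length v \<noteq> 1" using I(2) uvz(3) by auto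
    ultimately have "1 < length v" by (cases "length v") auto
    moreover have "length v \<noteq> length \<pi>" using I(3) uvz by (auto simp: lessThan_atLeast0)
    then have "length v < length \<pi>" using uvz(1) by auto
    ultimately show thesis using that uvz by blast
  qed
qed

text \<open>The labels in \<open>v\<close> are contracted to \<open>hd v\<close> and their blocks
  joined. Every entry still lies in an old block, whose label is unchanged or belongs to
  \<open>v\<close>; labels outside \<open>v\<close> compare alike with all of \<open>v\<close>, so
  \<open>hd v\<close> can stand for the old label.\<close>

lemma compatible_contract:
  assumes dist: "distinct (u @ v @ z)" and hom: "homogeneous u v z" and v: "v \<noteq> []"
    and len: "length U = length u" "length V = length v" "length Z = length z"
    and comp: "compatible (u @ v @ z) (U @ V @ Z)"
  shows "compatible (u @ [hd v] @ z) (U @ [concat V] @ Z)"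
proof -
  let ?new = "set (zip (u @ [hd v] @ z) (U @ [concat V] @ Z))"
  let ?old = "set (zip (u @ v @ z) (U @ V @ Z))"
  have old: "\<exists>p w. (p, w) \<in> ?old \<and> x \<in> set w \<and> (p = fst a \<or> fst a = hd v \<and> p \<in> set v)"
    if a: "a \<in> ?new" and x: "x \<in> set (snd a)" for a x
  proof -
    consider "a \<in> set (zip u U)" | "a = (hd v, concat V)" | "a \<in> set (zip z Z)"
      using a len by fastforce
    then show ?thesis
    proof cases
      case 1
      then show ?thesis using x len by (intro exI[of _ "fst a"] exI[of _ "snd a"]) simp
    next
      case 2
      then obtain i where i: "i < length V" "x \<in> set (V ! i)" using x in_set_concat_nth[of x V] by auto
      then have "(v ! i, V ! i) \<in> set (zip v V)" using len by (auto simp: set_zip)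
      then show ?thesis using 2 i len by (intro exI[of _ "v ! i"] exI[of _ "V ! i"]) simp
    next
      case 3
      then show ?thesis using x len by (intro exI[of _ "fst a"] exI[of _ "snd a"]) simp
    qed
  qed
  have key: "fst a \<in> set (u @ z) \<or> fst a = hd v" if "a \<in> ?new" for a
  proof -
    have "(fst a, snd a) \<in> ?new" using that by simp
    then have "fst a \<in> set (u @ [hd v] @ z)" by (rule set_zip_leftD)
    then show ?thesis by auto
  qed
  have hd: "hd v \<in> set v" using v by simp
  have less: "c < x \<longleftrightarrow> c < y" "x < c \<longleftrightarrow> y < c" if "c \<in> set (u @ z)" "x \<in> set v" "y \<in> set v" for c x y
  proof -
    show "c < x \<longleftrightarrow> c < y" using hom that unfolding homogeneous_def by blast
    moreover have "c \<noteq> x" "c \<noteq> y" using dist that by auto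
    ultimately show "x < c \<longleftrightarrow> y < c" by linarith
  qed
  show ?thesis
    unfolding compatible_def
  proof (intro ballI impI)
    fix a b x y
    assume ab: "a \<in> ?new" "b \<in> ?new" "fst a < fst b" and x: "x \<in> set (snd a)" and y: "y \<in> set (snd b)"
    obtain p w where p: "(p, w) \<in> ?old" "x \<in> set w" "p = fst a \<or> fst a = hd v \<and> p \<in> set v"
      using old[OF ab(1) x] by blast
    obtain q w' where q: "(q, w') \<in> ?old" "y \<in> set w'" "q = fst b \<or> fst b = hd v \<and> q \<in> set v"
      using old[OF ab(2) y] by blast
    have "p < q"
    proof (cases "p = fst a")
      case True
      show ?thesis
      proof (cases "q = fst b")
        case False
        then have "fst b = hd v" "q \<in> set v" using q(3) by auto
        then show ?thesis using True less(1)[of "fst a" "hd v" q] hd key[OF ab(1)] ab(3) by auto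
      qed (use True ab(3) in simp)
    next
      case False
      then have "fst a = hd v" "p \<in> set v" using p(3) by auto
      moreover from this have "fst b \<in> set (u @ z)" "q = fst b" using key[OF ab(2)] ab(3) q(3) by auto
      ultimately show ?thesis using less(2)[of "fst b" "hd v" p] hd ab(3) by simp
    qed
    then show "x < y" using comp p q unfolding compatible_def by fastforce
  qed
qed

text \<open>As long as \<open>\<pi>\<close> is not of the desired form, a proper homogeneous segment
  is contracted and the labels are standardized again. The segment has at least two entries, so the
  length drops; it is proper, so at least two labels remain.\<close>

lemma simple_decomposition_aux:
  assumes "is_perm \<pi>" "2 \<le> length \<pi>" "length vs = length \<pi>" "compatible \<pi> vs" "[] \<notin> set vs"
  shows "\<exists>\<pi>' vs'. is_perm \<pi>' \<and> (\<pi>' = oplus \<or> \<pi>' = ominus \<or> simple_perm \<pi>') \<and>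
    length vs' = length \<pi>' \<and> compatible \<pi>' vs' \<and> [] \<notin> set vs' \<and> concat vs' = concat vs"
  using assms
proof (induction "length \<pi>" arbitrary: \<pi> vs rule: less_induct)
  case less
  show ?case
  proof (cases "\<pi> = oplus \<or> \<pi> = ominus \<or> simple_perm \<pi>")
    case True
    then show ?thesis using less.prems by blast
  next
    case False
    then obtain u v z where uvz: "\<pi> = u @ v @ z" "homogeneous u v z" "1 < length v" "length v < length \<pi>"
      using exists_homogeneous_split[OF less.prems(1,2)] by metis
    define U V Z where "U = take (length u) vs" and "V = take (length v) (drop (length u) vs)"
      and "Z = drop (length v) (drop (length u) vs)"
    have vs: "vs = U @ V @ Z" by (simp only: U_def V_def Z_def append_take_drop_id)
    have len: "length U = length u" "length V = length v" "length Z = length z"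
      using less.prems(3) uvz(1) by (simp_all add: U_def V_def Z_def)
    define \<rho> where "\<rho> = u @ [hd v] @ z"
    have "v \<noteq> []" using uvz(3) by auto
    have dist: "distinct (u @ v @ z)" using is_perm_distinct[OF less.prems(1)] uvz(1) by simp
    then have dist': "distinct \<rho>" using hd_in_set[OF \<open>v \<noteq> []\<close>] unfolding \<rho>_def by auto
    have comp: "compatible \<rho> (U @ [concat V] @ Z)"
      unfolding \<rho>_def
      by (rule compatible_contract[OF dist uvz(2) \<open>v \<noteq> []\<close> len]) (use less.prems(4) uvz(1) vs in simp)
    obtain r where r: "std \<rho> = map r \<rho>" "strict_mono_on (set \<rho>) r" by (rule std_eq_map)
    have "\<exists>\<pi>' vs'. is_perm \<pi>' \<and> (\<pi>' = oplus \<or> \<pi>' = ominus \<or> simple_perm \<pi>') \<and>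
      length vs' = length \<pi>' \<and> compatible \<pi>' vs' \<and> [] \<notin> set vs' \<and>
      concat vs' = concat (U @ [concat V] @ Z)"
    proof (rule less.hyps)
      show "length (std \<rho>) < length \<pi>" using uvz by (simp add: \<rho>_def)
      show "is_perm (std \<rho>)" by (rule is_perm_std[OF dist'])
      show "2 \<le> length (std \<rho>)" using uvz(1,4) by (cases u; cases z) (simp_all add: \<rho>_def)
      show "length (U @ [concat V] @ Z) = length (std \<rho>)" by (simp add: \<rho>_def len)
      show "compatible (std \<rho>) (U @ [concat V] @ Z)"
        unfolding r(1) by (rule compatible_map[OF r(2) comp])
      have "V \<noteq> []" using len uvz(3) by auto
      then show "[] \<notin> set (U @ [concat V] @ Z)"
        using less.prems(5) vs by (cases V) auto
    qed
    then show ?thesis by (simp add: vs)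
  qed
qed

text \<open>The contraction starts with the single entries of \<open>\<sigma>\<close> as blocks.
  Choosing one entry from each nonempty block shows that \<open>\<pi>\<close> occurs in
  \<open>\<sigma>\<close>, and the blocks are segments of \<open>\<sigma>\<close>; so a class
  containing \<open>\<sigma>\<close> contains all of these.\<close>

lemma simple_decomposition:
  assumes \<sigma>: "is_perm \<sigma>" and len: "2 \<le> length \<sigma>"
  obtains \<pi> \<sigma>s where "\<sigma> = inflate \<pi> \<sigma>s" "\<pi> = oplus \<or> \<pi> = ominus \<or> simple_perm \<pi>"
    "length \<sigma>s = length \<pi>" "is_pattern \<pi> \<sigma>" "\<forall>\<tau>\<in>set \<sigma>s. \<tau> \<noteq> [] \<and> is_pattern \<tau> \<sigma>"
proof -
  obtain \<pi> vs where \<pi>: "is_perm \<pi>" "\<pi> = oplus \<or> \<pi> = ominus \<or> simple_perm \<pi>"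
    and vs: "length vs = length \<pi>" "compatible \<pi> vs" "[] \<notin> set vs" "concat vs = \<sigma>"
    using simple_decomposition_aux[OF \<sigma> len _ compatible_singletons] by auto
  have eq: "\<sigma> = inflate \<pi> (map std vs)"
    using concat_eq_inflate[OF is_perm_distinct[OF \<pi>(1)] vs(1,2)] vs(4) \<sigma> by simp
  have dist: "distinct v" if "v \<in> set vs" for v
    using that distinct_concat_nth[of vs] is_perm_distinct[OF \<sigma>] vs(4) by (auto simp: in_set_conv_nth)
  have perms: "\<forall>\<tau>\<in>set (map std vs). is_perm \<tau>" using dist is_perm_std by auto
  have ne: "std v \<noteq> []" if "v \<in> set vs" for v using vs(3) that by (auto simp: std_def)
  have "is_pattern \<pi> \<sigma>"
    unfolding eq using vs(1) ne \<pi>(1)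
    by (subst is_pattern_inflate_iff[OF \<pi>(1) _ perms \<pi>(1)])
      (auto intro!: exI[of _ "map (\<lambda>x. [x]) \<pi>"] compatible_singletons is_pattern_singleton[simplified])
  moreover have "is_pattern (std v) \<sigma>" if "v \<in> set vs" for v
  proof -
    obtain xs ys where "vs = xs @ v # ys" using split_list[OF \<open>v \<in> set vs\<close>] by blast
    then have "subseq v \<sigma>" using vs(4) by (auto intro: list_emb_append2 list_emb_prefix)
    then show ?thesis by (auto simp: is_pattern_iff)
  qed
  ultimately show thesis using that[OF eq \<pi>(2)] vs(1) ne by auto
qed


section \<open>Permutation classes\<close>

text \<open>Descent to a smaller permutation outside \<open>\<C>\<close>: a pattern of
  \<open>\<sigma>\<close> of the same size is \<open>\<sigma>\<close> itself.\<close>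

lemma contains_basis_element:
  assumes "is_perm \<sigma>" "\<sigma> \<noteq> []" "\<sigma> \<notin> \<C>"
  shows "\<exists>\<beta>\<in>basis \<C>. is_pattern \<beta> \<sigma>"
  using assms
proof (induction "length \<sigma>" arbitrary: \<sigma> rule: less_induct)
  case less
  show ?case
  proof (cases "\<sigma> \<in> basis \<C>")
    case True
    then show ?thesis using is_pattern_refl[OF less.prems(1)] by blast
  next
    case False
    then obtain \<pi> where \<pi>: "is_perm \<pi>" "\<pi> \<noteq> []" "\<pi> \<notin> \<C>" "is_pattern \<pi> \<sigma>" "\<pi> \<noteq> \<sigma>"
      using less.prems unfolding basis_def by blast
    obtain t where t: "subseq t \<sigma>" "std t = \<pi>" using \<pi>(4) by (auto simp: is_pattern_iff)
    have "length \<pi> \<noteq> length \<sigma>"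
      using t \<pi>(5) std_perm[OF less.prems(1)] subseq_same_length[OF t(1)] by auto
    then have "length \<pi> < length \<sigma>" using is_pattern_length[OF \<pi>(4)] by simp
    then obtain \<beta> where "\<beta> \<in> basis \<C>" "is_pattern \<beta> \<pi>" using less.hyps \<pi>(1-3) by blast
    then show ?thesis using is_pattern_trans[OF _ \<pi>(4) is_perm_distinct[OF less.prems(1)]] by blast
  qed
qed

lemma perm_classD:
  assumes "perm_class \<C>" "\<sigma> \<in> \<C>"
  shows "is_perm \<sigma>" "\<sigma> \<noteq> []" "\<And>\<pi>. \<pi> \<noteq> [] \<Longrightarrow> is_pattern \<pi> \<sigma> \<Longrightarrow> \<pi> \<in> \<C>"
  using assms unfolding perm_class_def by blast+

lemma class_avoids_basis:
  assumes "perm_class \<C>" "\<sigma> \<in> \<C>" "\<beta> \<in> basis \<C>"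
  shows "\<not> is_pattern \<beta> \<sigma>"
  using assms perm_classD(3)[of \<C> \<sigma> \<beta>] unfolding basis_def by blast

lemma subst_power_is_perm:
  assumes "perm_class \<C>"
  shows "\<sigma> \<in> subst_power \<C> k \<Longrightarrow> is_perm \<sigma> \<and> \<sigma> \<noteq> []"
proof (induction k arbitrary: \<sigma>)
  case 0
  then show ?case using perm_classD(1,2)[OF assms] by simp
next
  case (Suc k)
  then obtain \<pi> \<sigma>s where *: "\<sigma> = inflate \<pi> \<sigma>s" "\<pi> \<in> \<C>" "length \<sigma>s = length \<pi>"
    "set \<sigma>s \<subseteq> subst_power \<C> k" by auto
  have "\<forall>\<tau>\<in>set \<sigma>s. is_perm \<tau> \<and> \<tau> \<noteq> []" using Suc.IH *(4) by blast
  then show ?case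
    unfolding *(1) using *(3) perm_classD(1,2)[OF assms *(2)]
    by (simp add: is_perm_inflate inflate_ne_Nil)
qed

text \<open>At each substitution a simple pattern comes from the outer permutation or from a single
  component, so it can be traced back to an element of \<open>\<C>\<close>.\<close>

lemma simple_pattern_subst_power:
  assumes "perm_class \<C>" "simple_perm \<beta>"
  shows "\<sigma> \<in> subst_power \<C> k \<Longrightarrow> is_pattern \<beta> \<sigma> \<Longrightarrow> \<beta> \<in> \<C>"
proof (induction k arbitrary: \<sigma>)
  case 0
  moreover have "\<beta> \<noteq> []" using assms(2) by (auto simp: simple_perm_def)
  ultimately show ?case using perm_classD(3)[OF assms(1)] by auto
next
  case (Suc k)
  then obtain \<pi> \<sigma>s where *: "\<sigma> = inflate \<pi> \<sigma>s" "\<pi> \<in> \<C>" "length \<sigma>s = length \<pi>"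
    "set \<sigma>s \<subseteq> subst_power \<C> k" by auto
  moreover have "\<forall>\<tau>\<in>set \<sigma>s. is_perm \<tau>" using *(4) subst_power_is_perm[OF assms(1)] by blast
  ultimately have "is_pattern \<beta> \<pi> \<or> (\<exists>\<tau>\<in>set \<sigma>s. is_pattern \<beta> \<tau>)"
    using simple_pattern_inflate[OF assms(2)] perm_classD(1)[OF assms(1)] Suc.prems(2) by blast
  moreover have "\<beta> \<noteq> []" using assms(2) by (auto simp: simple_perm_def)
  ultimately show ?case using perm_classD(3)[OF assms(1) *(2)] Suc.IH *(4) by blast
qed

text \<open>An element of the closure outside \<open>\<C>\<close> contains a basis element. Avoiding
  \<open>basis_star \<C>\<close> forces that element to be simple, but simple patterns of the
  closure lie in \<open>\<C>\<close>.\<close>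

lemma denotes_Full:
  assumes \<C>: "perm_class \<C>"
  shows "denotes \<C> (Full, Bs) = avoiders \<C> (set Bs)"
proof (intro set_eqI iffI)
  fix \<sigma> assume \<sigma>: "\<sigma> \<in> denotes \<C> (Full, Bs)"
  then obtain k where k: "\<sigma> \<in> subst_power \<C> k" by (auto simp: avoiders_def subst_closure_def)
  have "\<sigma> \<in> \<C>"
  proof (rule ccontr)
    assume "\<sigma> \<notin> \<C>"
    then obtain \<beta> where \<beta>: "\<beta> \<in> basis \<C>" "is_pattern \<beta> \<sigma>"
      using contains_basis_element subst_power_is_perm[OF \<C> k] by blast
    then have "simple_perm \<beta>" using \<sigma> by (auto simp: avoiders_def avoids_def basis_star_def)
    then have "\<beta> \<in> \<C>" using simple_pattern_subst_power[OF \<C> _ k] \<beta>(2) by blast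
    then show False using \<beta>(1) by (simp add: basis_def)
  qed
  then show "\<sigma> \<in> avoiders \<C> (set Bs)" using \<sigma> by (auto simp: avoiders_def)
next
  fix \<sigma> assume \<sigma>: "\<sigma> \<in> avoiders \<C> (set Bs)"
  then have "\<sigma> \<in> subst_power \<C> 0" by (simp add: avoiders_def)
  then have "\<sigma> \<in> subst_closure \<C>" unfolding subst_closure_def by blast
  then show "\<sigma> \<in> denotes \<C> (Full, Bs)"
    using \<sigma> class_avoids_basis[OF \<C>] by (auto simp: avoiders_def avoids_def basis_star_def)
qed


section \<open>The system of equations\<close>

text \<open>
  Blocks of size 1 are excluded because an unknown that avoids \<open>1\<close> denotes the empty set, whereas
  every equation contributes \<open>{1}\<close>.  With the whole permutation excluded as well, a simple
  permutation has no proper blocks, so that the algorithm may use \<open>B\<close> and never has to compute \<open>B\<^sup>\<star>\<close>.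
\<close>

definition proper_blocks :: "perm \<Rightarrow> perm list" where
  "proper_blocks w = map std (filter (\<lambda>v. 1 < length v \<and> length v < length w \<and>
     (\<exists>u\<in>set (subseqs w). \<exists>z\<in>set (subseqs w). u @ v @ z = w \<and> homogeneous u v z)) (subseqs w))"

text \<open>
  A decidable sufficient condition for \<open>\<pi>[D\<^sub>1, \<dots>, D\<^sub>n]\<close> to avoid \<open>bs\<close> and \<open>Bs\<close>: every way of
  spreading a forbidden pattern over the blocks puts a forbidden pattern into one of them.
\<close>

definition admissible :: "perm list \<Rightarrow> perm list \<Rightarrow> perm \<Rightarrow> perm list list \<Rightarrow> bool" where
  "admissible bs Bs \<pi> Ds \<longleftrightarrow> (\<forall>\<beta>\<in>set (bs @ Bs). \<forall>vs\<in>set (List.n_lists (length \<pi>) (subseqs \<beta>)).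
     concat vs = \<beta> \<and> compatible \<pi> vs \<longrightarrow> (\<exists>a\<in>set (zip vs Ds). std (fst a) \<in> set (bs @ snd a)))"

text \<open>Sublists of one fixed list represent all sets of blocks. Filtering the fixed list always
  yields a member of this finite family.\<close>

definition block_sets :: "perm list \<Rightarrow> perm list list" where
  "block_sets bs = subseqs (concat (map proper_blocks bs))"

definition summands :: "perm list \<Rightarrow> perm list \<Rightarrow> perm list \<Rightarrow> summand list" where
  "summands bs ss Bs = concat (map (\<lambda>\<pi>. map (\<lambda>Ds. (\<pi>, map (\<lambda>D. (Full, D)) Ds))
     (filter (\<lambda>Ds. admissible bs Bs \<pi> Ds) (List.n_lists (length \<pi>) (block_sets bs)))) (oplus # ominus # ss))"

text \<open>Every member of the family gets an equation, and all unknowns in the summands are named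
  from the same family, so completeness is built in.\<close>

definition equation_system :: "perm list \<Rightarrow> perm list \<Rightarrow> eq_system" where
  "equation_system bs ss = map (\<lambda>Bs. ((Full, Bs), summands bs ss Bs)) (block_sets bs)"

section \<open>Blocks of forbidden patterns\<close>

lemma set_proper_blocks:
  "\<gamma> \<in> set (proper_blocks w) \<longleftrightarrow> (\<exists>u v z. w = u @ v @ z \<and> homogeneous u v z \<and>
     1 < length v \<and> length v < length w \<and> \<gamma> = std v)" (is "_ \<longleftrightarrow> ?R")
proof
  assume "\<gamma> \<in> set (proper_blocks w)"
  then show ?R by (auto simp: proper_blocks_def)
next
  assume ?R
  then obtain u v z where *: "w = u @ v @ z" "homogeneous u v z" "1 < length v" "length v < length w"
    "\<gamma> = std v" by blast
  then have "subseq u w" "subseq v w" "subseq z w"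
    by (auto intro: list_emb_append2 list_emb_prefix)
  then have "v \<in> set (filter (\<lambda>v. 1 < length v \<and> length v < length w \<and>
     (\<exists>u\<in>set (subseqs w). \<exists>z\<in>set (subseqs w). u @ v @ z = w \<and> homogeneous u v z)) (subseqs w))"
    using *(2-4) unfolding set_filter mem_Collect_eq in_set_subseqs Bex_def by (metis *(1))
  then show "\<gamma> \<in> set (proper_blocks w)" using *(5) unfolding proper_blocks_def set_map by blast
qed

text \<open>Elements of \<open>Bs\<close> are themselves blocks, and splitting them must not lead
  outside the blocks of the basis. An entry outside the outer block compares alike with all of it;
  for one inside the outer block, the increasing map \<open>r\<close> transfers the
  comparison.\<close>

lemma proper_blocks_trans:
  assumes w: "distinct w" and \<gamma>: "\<gamma> \<in> set (proper_blocks w)" and \<delta>: "\<delta> \<in> set (proper_blocks \<gamma>)"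
  shows "\<delta> \<in> set (proper_blocks w)"
proof -
  obtain u v z where uvz: "w = u @ v @ z" "homogeneous u v z" "length v < length w" "\<gamma> = std v"
    using \<gamma> unfolding set_proper_blocks by blast
  obtain r where r: "std v = map r v" "strict_mono_on (set v) r" by (rule std_eq_map)
  obtain u' v' z' where v': "v = u' @ v' @ z'" "homogeneous (map r u') (map r v') (map r z')"
    "1 < length v'" "length v' < length v" "\<delta> = std (map r v')"
  proof -
    obtain u0 v0 z0 where *: "map r v = u0 @ v0 @ z0" "homogeneous u0 v0 z0" "1 < length v0"
      "length v0 < length v" "\<delta> = std v0"
      using \<delta> unfolding set_proper_blocks uvz(4) r(1) by auto
    obtain u' y where y: "v = u' @ y" "u0 = map r u'" "v0 @ z0 = map r y"
      using *(1) by (auto simp: map_eq_append_conv)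
    obtain v' z' where "y = v' @ z'" "v0 = map r v'" "z0 = map r z'"
      using y(3) by (metis map_eq_append_conv)
    then show thesis using that[of u' v' z'] y * by simp
  qed
  have "\<delta> = std v'"
    unfolding v'(5) using r(2) v'(1) w uvz(1)
    by (intro std_map) (auto intro: monotone_on_subset)
  moreover have "homogeneous (u @ u') v' (z' @ z)"
    unfolding homogeneous_def
  proof (intro ballI impI)
    fix c x y assume c: "c \<in> set ((u @ u') @ z' @ z)" and xy: "x \<in> set v'" "y \<in> set v'" "c < x"
    have xy': "x \<in> set v" "y \<in> set v" using xy v'(1) by auto
    show "c < y"
    proof (cases "c \<in> set (u @ z)")
      case True
      then show ?thesis using uvz(2) xy' xy(3) unfolding homogeneous_def by blast
    next
      case False
      then have c': "c \<in> set (u' @ z')" "c \<in> set v" using c v'(1) by auto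
      then have "r c < r x" using r(2) xy' xy(3) by (simp add: strict_mono_on_less)
      then have "r c < r y" using v'(2) c'(1) xy(1,2) unfolding homogeneous_def by auto
      then show ?thesis using r(2) xy' c'(2) by (simp add: strict_mono_on_less)
    qed
  qed
  moreover have "w = (u @ u') @ v' @ (z' @ z)" using uvz(1) v'(1) by simp
  moreover have "length v' < length w" using v'(4) uvz(3) by simp
  ultimately show ?thesis using v'(3) unfolding set_proper_blocks by blast
qed

text \<open>The segment is an interval with more than one entry and fewer than all. This also rules
  out simplicity, so every block that arises comes from an element of
  \<open>basis_star \<C>\<close>.\<close>

lemma proper_block_normalized:
  assumes \<beta>: "is_perm \<beta>" and \<gamma>: "\<gamma> \<in> set (proper_blocks \<beta>)"
  shows "normalized_block \<gamma> \<beta>" "\<not> simple_perm \<beta>"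
proof -
  obtain u v z where uvz: "\<beta> = u @ v @ z" "homogeneous u v z" "1 < length v" "length v < length \<beta>"
    "\<gamma> = std v"
    using \<gamma> unfolding set_proper_blocks by blast
  let ?I = "{length u..<length u + length v}"
  have I: "is_interval \<beta> ?I"
    using is_interval_middle[of u v z] \<beta> uvz(1-3) by fastforce
  moreover have "subperm \<beta> ?I = \<gamma>" unfolding subperm_def uvz(1,5) nths_middle ..
  ultimately show "normalized_block \<gamma> \<beta>" unfolding normalized_block_def by blast
  have "card ?I \<noteq> 1" "card ?I \<noteq> card {..<length \<beta>}" using uvz(3,4) by simp_all
  then have "\<nexists>i. ?I = {i}" "?I \<noteq> {..<length \<beta>}" by (metis is_singletonI is_singleton_altdef, metis)
  then show "\<not> simple_perm \<beta>" using I unfolding simple_perm_def by blast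
qed

text \<open>For one inclusion, \<open>\<sigma>\<close> is decomposed and each component is labelled
  with the blocks it avoids. For the other, admissible labels keep every pattern in
  \<open>bs\<close> and \<open>Bs\<close> out of the substitution.\<close>

lemma avoiders_eq_union:
  assumes \<C>: "perm_class \<C>" and ops: "oplus \<in> \<C>" "ominus \<in> \<C>"
    and bs: "set bs = basis \<C>" and ss: "set ss = simples \<C>" and Bs: "Bs \<in> set (block_sets bs)"
  shows "avoiders \<C> (set Bs) = {[1]} \<union> (\<Union>\<pi>\<in>set (oplus # ominus # ss).
    \<Union>Ds\<in>{Ds \<in> set (List.n_lists (length \<pi>) (block_sets bs)). admissible bs Bs \<pi> Ds}.
      inflate_sets \<pi> (map (\<lambda>D. avoiders \<C> (set D)) Ds))" (is "_ = ?R")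
proof (intro set_eqI iffI)
  let ?blocks = "concat (map proper_blocks bs)"
  have block: "is_perm \<gamma>" "1 < length \<gamma>" if "\<gamma> \<in> set ?blocks" for \<gamma>
  proof -
    obtain \<beta> where \<beta>: "\<beta> \<in> basis \<C>" "\<gamma> \<in> set (proper_blocks \<beta>)" using \<open>\<gamma> \<in> set ?blocks\<close> bs by auto
    then have "distinct \<beta>" by (simp add: basis_def is_perm_def)
    then show "is_perm \<gamma>" "1 < length \<gamma>" using \<beta>(2) unfolding set_proper_blocks
      by (auto intro: is_perm_std)
  qed
  have Bs_blocks: "set D \<subseteq> set ?blocks" if "D \<in> set (block_sets bs)" for D
    using that unfolding block_sets_def in_set_subseqs by (rule subseq_set_subset)
  have perm: "is_perm \<beta>" if "\<beta> \<in> set (bs @ Bs)" for \<beta>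
  proof (cases "\<beta> \<in> set bs")
    case True
    then show ?thesis unfolding bs by (simp add: basis_def)
  next
    case False
    then have "\<beta> \<in> set Bs" using that by simp
    then show ?thesis using block(1) Bs_blocks[OF Bs] by blast
  qed
  have \<pi>_class: "\<pi> \<in> \<C>" if "\<pi> \<in> set (oplus # ominus # ss)" for \<pi>
    using that ops ss by (auto simp: simples_def)
  {
    fix \<sigma> assume \<sigma>: "\<sigma> \<in> avoiders \<C> (set Bs)"
    then have "\<sigma> \<in> \<C>" by (simp add: avoiders_def)
    note \<sigma>_perm = perm_classD[OF \<C> this]
    show "\<sigma> \<in> ?R"
    proof (cases "2 \<le> length \<sigma>")
      case False
      then have "length \<sigma> = 1" using \<sigma>_perm(2) by (simp add: not_le less_2_cases_iff)
      then have "\<sigma> = [1]" using \<sigma>_perm(1) by (auto simp: is_perm_def length_Suc_conv)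
      then show ?thesis by simp
    next
      case True
      obtain \<pi> \<sigma>s where dec: "\<sigma> = inflate \<pi> \<sigma>s" "\<pi> = oplus \<or> \<pi> = ominus \<or> simple_perm \<pi>"
        "length \<sigma>s = length \<pi>" "is_pattern \<pi> \<sigma>" "\<forall>\<tau>\<in>set \<sigma>s. \<tau> \<noteq> [] \<and> is_pattern \<tau> \<sigma>"
        by (rule simple_decomposition[OF \<sigma>_perm(1) True])
      have "\<pi> \<noteq> []" using dec(2) by (auto simp: simple_perm_def)
      then have "\<pi> \<in> \<C>" using \<sigma>_perm(3) dec(4) by blast
      then have \<pi>: "\<pi> \<in> set (oplus # ominus # ss)" using dec(2) ss by (auto simp: simples_def)
      have \<pi>_perm: "is_perm \<pi>" using perm_classD(1)[OF \<C> \<open>\<pi> \<in> \<C>\<close>] .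
      have \<sigma>s: "\<forall>\<tau>\<in>set \<sigma>s. \<tau> \<in> \<C>" using dec(5) \<sigma>_perm(3) by blast
      have \<sigma>s_perm: "\<forall>\<tau>\<in>set \<sigma>s. is_perm \<tau>" using \<sigma>s perm_classD(1)[OF \<C>] by blast
      \<comment> \<open>The largest possible labels. Each component satisfies its label by
        construction, and admissibility is easiest to meet.\<close>
      define Ds where "Ds = map (\<lambda>\<tau>. filter (\<lambda>\<gamma>. \<not> is_pattern \<gamma> \<tau>) ?blocks) \<sigma>s"
      have "Ds \<in> set (List.n_lists (length \<pi>) (block_sets bs))"
        by (auto simp: set_n_lists Ds_def dec(3) block_sets_def)
      moreover have "admissible bs Bs \<pi> Ds"
        unfolding admissible_def
      proof (intro ballI impI)
        fix \<beta> vs assume \<beta>: "\<beta> \<in> set (bs @ Bs)" and "vs \<in> set (List.n_lists (length \<pi>) (subseqs \<beta>))"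
          and vs: "concat vs = \<beta> \<and> compatible \<pi> vs"
        then have len: "length vs = length \<pi>" by (simp add: set_n_lists)
        have "\<not> is_pattern \<beta> \<sigma>"
          using \<beta> \<sigma> bs class_avoids_basis[OF \<C> \<open>\<sigma> \<in> \<C>\<close>] by (auto simp: avoiders_def avoids_def)
        then obtain i where i: "i < length \<pi>" "\<not> is_pattern (std (vs ! i)) (\<sigma>s ! i)"
          using is_pattern_inflate_iff[OF \<pi>_perm dec(3) \<sigma>s_perm perm[OF \<beta>]] vs len dec(1) by blast
        have ne: "\<sigma>s ! i \<noteq> []" using i(1) dec(3,5) by auto
        \<comment> \<open>Pieces of size 0 and 1 occur in every nonempty permutation, so leaving out
          blocks of size 1 loses nothing here.\<close>
        have "1 < length (vs ! i)"
        proof (rule ccontr)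
          assume "\<not> 1 < length (vs ! i)"
          then consider "vs ! i = []" | x where "vs ! i = [x]" by (cases "vs ! i") auto
          then show False
            using i(2) by cases (simp_all add: is_pattern_Nil is_pattern_singleton[OF ne, simplified])
        qed
        obtain u z where uz: "\<beta> = u @ vs ! i @ z" "homogeneous u (vs ! i) z"
          using compatible_homogeneous[OF is_perm_distinct[OF \<pi>_perm] len conjunct2[OF vs] i(1)]
          unfolding conjunct1[OF vs] by blast
        \<comment> \<open>If the avoided piece is a proper part of \<open>\<beta>\<close>, it is a
          block of a basis element, by transitivity when \<open>\<beta>\<close> is itself such a
          block. Otherwise it is \<open>\<beta>\<close>, which lies in \<open>bs\<close> or is again
          one of the blocks.\<close>
        have "std (vs ! i) \<in> set (bs @ Ds ! i)"
        proof (cases "std (vs ! i) \<in> set ?blocks")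
          case True
          then show ?thesis using i dec(3) by (simp add: Ds_def)
        next
          case False
          have no_block: "std (vs ! i) \<notin> set (proper_blocks \<beta>)"
          proof
            assume "std (vs ! i) \<in> set (proper_blocks \<beta>)"
            moreover from this False have "\<beta> \<notin> set bs" by auto
            then have "\<beta> \<in> set ?blocks" using \<beta> Bs_blocks[OF Bs] unfolding set_append by blast
            then obtain \<beta>' where \<beta>': "\<beta>' \<in> set bs" "\<beta> \<in> set (proper_blocks \<beta>')" by auto
            moreover have "distinct \<beta>'" using perm \<beta>'(1) by (simp add: is_perm_distinct)
            ultimately have "std (vs ! i) \<in> set (proper_blocks \<beta>')"
              using proper_blocks_trans by blast
            then show False using False \<beta>'(1) by auto
          qed
          have "length (vs ! i) = length \<beta>"
          proof (rule ccontr)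
            assume "length (vs ! i) \<noteq> length \<beta>"
            then have "length (vs ! i) < length \<beta>" using arg_cong[OF uz(1), of length] by simp
            then show False
              using no_block uz \<open>1 < length (vs ! i)\<close> unfolding set_proper_blocks by metis
          qed
          then have "vs ! i = \<beta>" using arg_cong[OF uz(1), of length] uz(1) by simp
          then have "std (vs ! i) = \<beta>" using std_perm[OF perm[OF \<beta>]] by simp
          then show ?thesis using False \<beta> Bs_blocks[OF Bs] unfolding set_append by blast
        qed
        moreover have "(vs ! i, Ds ! i) \<in> set (zip vs Ds)"
          using i(1) len dec(3) by (auto simp: set_zip Ds_def)
        ultimately show "\<exists>a\<in>set (zip vs Ds). std (fst a) \<in> set (bs @ snd a)"
          by (metis fst_conv snd_conv)
      qed
      moreover have "\<sigma> \<in> inflate_sets \<pi> (map (\<lambda>D. avoiders \<C> (set D)) Ds)"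
        unfolding inflate_sets_def using dec(1) \<sigma>s
        by (auto simp: Ds_def list_all2_conv_all_nth avoiders_def avoids_def intro!: exI[of _ \<sigma>s])
      ultimately show ?thesis using \<pi> by blast
    qed
  next
    fix \<sigma> assume "\<sigma> \<in> ?R"
    then consider "\<sigma> = [1]"
      | \<pi> Ds where "\<pi> \<in> set (oplus # ominus # ss)" "Ds \<in> set (List.n_lists (length \<pi>) (block_sets bs))"
        "admissible bs Bs \<pi> Ds" "\<sigma> \<in> inflate_sets \<pi> (map (\<lambda>D. avoiders \<C> (set D)) Ds)"
      by blast
    then show "\<sigma> \<in> avoiders \<C> (set Bs)"
    proof cases
      case 1
      \<comment> \<open>The permutation of size 1 is a pattern of \<open>12\<close>, and it avoids
        \<open>Bs\<close> because all blocks have size at least 2.\<close>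
      have "[1] \<in> \<C>" using perm_classD(3)[OF \<C> ops(1)] is_pattern_singleton by blast
      moreover have "\<not> is_pattern \<gamma> [1]" if "\<gamma> \<in> set Bs" for \<gamma>
        using that block(2) Bs_blocks[OF Bs] is_pattern_length[of \<gamma> "[1]"] by fastforce
      ultimately show ?thesis using 1 by (auto simp: avoiders_def avoids_def)
    next
      case (2 \<pi> Ds)
      note \<pi> = perm_classD[OF \<C> \<pi>_class[OF 2(1)]]
      have len_Ds: "length Ds = length \<pi>" using 2(2) by (simp add: set_n_lists)
      obtain \<sigma>s where \<sigma>s: "\<sigma> = inflate \<pi> \<sigma>s" "length \<sigma>s = length \<pi>"
        "\<And>i. i < length \<pi> \<Longrightarrow> \<sigma>s ! i \<in> avoiders \<C> (set (Ds ! i))"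
        using 2(4) len_Ds unfolding inflate_sets_def by (auto simp: list_all2_conv_all_nth)
      have "\<forall>\<tau>\<in>set \<sigma>s. \<tau> \<in> \<C>" using \<sigma>s(2,3) by (auto simp: in_set_conv_nth avoiders_def)
      then have \<sigma>s_perm: "\<forall>\<tau>\<in>set \<sigma>s. is_perm \<tau> \<and> \<tau> \<noteq> []" using perm_classD(1,2)[OF \<C>] by blast
      \<comment> \<open>An occurrence of \<open>\<beta>\<close> would split over the components, and
        admissibility names a piece in \<open>bs\<close> or \<open>Ds ! i\<close>, which
        \<open>\<sigma>s ! i\<close> avoids.\<close>
      have avoid: "\<not> is_pattern \<beta> \<sigma>" if \<beta>: "\<beta> \<in> set (bs @ Bs)" for \<beta>
      proof
        assume "is_pattern \<beta> \<sigma>"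
        then obtain vs where vs: "length vs = length \<pi>" "concat vs = \<beta>" "compatible \<pi> vs"
          and pat: "\<And>i. i < length \<pi> \<Longrightarrow> is_pattern (std (vs ! i)) (\<sigma>s ! i)"
          using is_pattern_inflate_iff[OF \<pi>(1) \<sigma>s(2) _ perm[OF \<beta>]] \<sigma>s_perm \<sigma>s(1) by blast
        have "vs \<in> set (List.n_lists (length \<pi>) (subseqs \<beta>))"
        proof -
          have "subseq v \<beta>" if "v \<in> set vs" for v
            using split_list[OF that] vs(2) by (auto intro: list_emb_append2 list_emb_prefix)
          then show ?thesis using vs(1) by (auto simp: set_n_lists)
        qed
        then obtain a where a: "a \<in> set (zip vs Ds)" "std (fst a) \<in> set (bs @ snd a)"
          using 2(3) \<beta> vs unfolding admissible_def by blast
        then obtain i where i: "i < length \<pi>" "std (vs ! i) \<in> set (bs @ Ds ! i)"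
          using vs(1) len_Ds by (auto simp: set_zip)
        then show False
          using pat[OF i(1)] \<sigma>s(3)[OF i(1)] class_avoids_basis[OF \<C>] bs
          by (auto simp: avoiders_def avoids_def)
      qed
      have "is_perm \<sigma>" "\<sigma> \<noteq> []"
        unfolding \<sigma>s(1) using \<sigma>s_perm \<sigma>s(2) \<pi>(1,2) by (simp_all add: is_perm_inflate inflate_ne_Nil)
      \<comment> \<open>The class is not assumed closed under substitution. Membership comes from
        avoiding the whole basis, which is why \<open>bs\<close> enters
        \<open>admissible\<close>.\<close>
      then have "\<sigma> \<in> \<C>" using contains_basis_element[of \<sigma> \<C>] avoid unfolding set_append bs by blast
      then show ?thesis using avoid by (auto simp: avoiders_def avoids_def)
    qed
  }
qed


section \<open>The algorithm\<close>

lemma computable_n_lists [computable_intros]: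
  assumes "computable f" "computable g"
  shows "computable (\<lambda>x. List.n_lists (f x) (g x))"
proof -
  have "computable (\<lambda>x. rec_nat [[]] (\<lambda>_ s. concat (map (\<lambda>ys. map (\<lambda>y. y # ys) (g x)) s)) (f x))"
    by (intro computable_rec_nat computable_intros assms computable_comp[OF assms(2)])
  moreover have "rec_nat [[]] (\<lambda>_ s. concat (map (\<lambda>ys. map (\<lambda>y. y # ys) xs) s)) n = List.n_lists n xs"
    for n and xs :: "'b list"
    by (induction n) simp_all
  ultimately show ?thesis by simp
qed

text \<open>A fold over the first list that carries the rest of the second one and collects the
  pairs in reverse order.\<close>

lemma computable_zip [computable_intros]:
  assumes "computable f" "computable g"
  shows "computable (\<lambda>x. zip (f x) (g x))"
proof -
  let ?step = "\<lambda>a st. case snd st of [] \<Rightarrow> st | b # bs \<Rightarrow> ((a, b) # fst st, bs)"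
  have "computable (\<lambda>x. rev (fst (fold ?step (f x) ([], g x))))"
    by (intro computable_intros computable_case_list assms)
  moreover have "fold ?step as (cs, bs) = (rev (zip as bs) @ cs, drop (length as) bs)"
    for as :: "'b list" and bs :: "'c list" and cs
    by (induction as arbitrary: bs cs) (auto split: list.split)
  ultimately show ?thesis by simp
qed

lemma computable_card_set [computable_intros]:
  assumes "computable f"
  shows "computable (\<lambda>x. card (set (f x)))"
proof -
  have "computable (\<lambda>x. length (fold (\<lambda>a s. if a \<in> set s then s else a # s) (f x) []))"
    by (intro computable_intros assms)
  moreover have "length (fold (\<lambda>a s. if a \<in> set s then s else a # s) as s) = card (set as \<union> set s)"
    if "distinct s" for as s :: "'b list"
    using that by (induction as arbitrary: s) (auto simp: distinct_card insert_absorb)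
  ultimately show ?thesis by simp
qed

lemma computable_std [computable_intros]:
  assumes "computable f"
  shows "computable (\<lambda>x. std (f x))"
proof -
  have "computable (\<lambda>x. map (\<lambda>a. card (set (filter (\<lambda>b. b \<le> a) (f x)))) (f x))"
    by (intro computable_intros assms computable_comp[OF assms])
  then show ?thesis by (simp add: std_def)
qed

lemma computable_homogeneous [computable_intros]:
  assumes "computable f" "computable g" "computable h"
  shows "computable (\<lambda>x. homogeneous (f x) (g x) (h x))"
  unfolding homogeneous_def
  by (intro computable_intros assms computable_comp[OF assms(2)])

lemma computable_compatible [computable_intros]:
  assumes "computable f" "computable g"
  shows "computable (\<lambda>x. compatible (f x) (g x))"
  unfolding compatible_def
  by (intro computable_intros assms computable_comp[OF assms(1)] computable_comp[OF assms(2)])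

lemma computable_proper_blocks [computable_intros]:
  assumes "computable f"
  shows "computable (\<lambda>x. proper_blocks (f x))"
  unfolding proper_blocks_def
  by (intro computable_intros assms computable_comp[OF assms])

lemma computable_admissible [computable_intros]:
  assumes "computable f" "computable g" "computable h" "computable k"
  shows "computable (\<lambda>x. admissible (f x) (g x) (h x) (k x))"
  unfolding admissible_def
  by (intro computable_intros assms computable_comp[OF assms(1)] computable_comp[OF assms(3)]
      computable_comp[OF assms(4)])

text \<open>The definitions involved use only list functions and quantifiers bounded by lists, so
  the closure rules suffice.\<close>

lemma computable_equation_system: "computable (\<lambda>z. equation_system (fst z) (snd z))"
  unfolding equation_system_def summands_def block_sets_def
  by (intro computable_intros)

section \<open>Codes of input and output\<close>

lemma encode_perm [simp]: "encode (w :: perm) = perm_code w"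
  by (simp add: encode_list_def map_idI)

lemma encode_perms [simp]: "encode (ps :: perm list) = perms_code ps"
  unfolding encode_list_def[of ps] perms_code_def by (simp cong: map_cong)

lemma encode_system: "encode (sys :: eq_system) = system_code sys"
proof -
  have unknown: "encode D = unknown_code D" for D :: unknown
    by (cases D) (simp add: encode_delta_def)
  then have summand: "encode s = summand_code s" for s :: summand
    by (cases s) (simp add: encode_list_def[of "_ :: unknown list"] cong: map_cong)
  then have "encode e = equation_code e" for e :: equation
    by (cases e) (simp add: encode_list_def[of "_ :: summand list"] unknown cong: map_cong)
  then show ?thesis by (simp add: encode_list_def[of sys] system_code_def cong: map_cong)
qed

theorem theorem5p1:
  shows "\<exists>algorithm :: program. \<forall>(\<C> :: perm set) (bs :: perm list) (ss :: perm list).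
    perm_class \<C> \<and> oplus \<in> \<C> \<and> ominus \<in> \<C> \<and> finite (simples \<C>) \<and>
    set bs = basis \<C> \<and> set ss = simples \<C> \<longrightarrow>
    (\<exists>sys :: eq_system.
       computes algorithm (input_code bs ss) (system_code sys) \<and>
       (\<forall>eqn \<in> set sys. (\<forall>s \<in> set (snd eqn). summand_ok s) \<and> equation_holds \<C> eqn) \<and>
       (\<forall>(\<delta>, Bs) \<in> unknowns sys. \<forall>\<pi> \<in> set Bs. \<exists>\<beta> \<in> basis_star \<C>. normalized_block \<pi> \<beta>) \<and>
       (\<exists>D \<in> lhs_unknowns sys. denotes \<C> D = \<C>) \<and>
       unknowns sys \<subseteq> lhs_unknowns sys)"
proof -
  \<comment> \<open>One program serves all inputs: it is fixed before any class is
    introduced.\<close>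
  obtain p where p: "computes p (encode z) (encode (equation_system (fst z) (snd z)))" for z
    using computable_equation_system unfolding computable_def recursive_def by metis
  show ?thesis
  proof (intro exI[of _ p] allI impI, elim conjE)
    fix \<C> :: "perm set" and bs ss :: "perm list"
    assume \<C>: "perm_class \<C>" and ops: "oplus \<in> \<C>" "ominus \<in> \<C>"
      and bs: "set bs = basis \<C>" and ss: "set ss = simples \<C>"
    let ?sys = "equation_system bs ss"
    have lhs: "lhs_unknowns ?sys = (\<lambda>Bs. (Full, Bs)) ` set (block_sets bs)"
      by (auto simp: lhs_unknowns_def equation_system_def image_image)
    \<comment> \<open>Every unknown in a summand is \<open>Full\<close> with a list from
      \<open>block_sets bs\<close>, and each such list has its own equation.\<close>
    have sub: "unknowns ?sys \<subseteq> lhs_unknowns ?sys"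
      unfolding unknowns_def lhs
      by (auto simp: equation_system_def lhs_unknowns_def summands_def set_n_lists)
    show "\<exists>sys. computes p (input_code bs ss) (system_code sys) \<and>
       (\<forall>eqn \<in> set sys. (\<forall>s \<in> set (snd eqn). summand_ok s) \<and> equation_holds \<C> eqn) \<and>
       (\<forall>(\<delta>, Bs) \<in> unknowns sys. \<forall>\<pi> \<in> set Bs. \<exists>\<beta> \<in> basis_star \<C>. normalized_block \<pi> \<beta>) \<and>
       (\<exists>D \<in> lhs_unknowns sys. denotes \<C> D = \<C>) \<and>
       unknowns sys \<subseteq> lhs_unknowns sys"
    proof (intro exI[of _ ?sys] conjI)
      show "computes p (input_code bs ss) (system_code ?sys)"
        using p[of "(bs, ss)"] by (simp add: encode_system input_code_def)
      show "\<forall>eqn \<in> set ?sys. (\<forall>s \<in> set (snd eqn). summand_ok s) \<and> equation_holds \<C> eqn"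
      proof
        fix eqn assume "eqn \<in> set ?sys"
        then obtain Bs where Bs: "Bs \<in> set (block_sets bs)" and eqn: "eqn = ((Full, Bs), summands bs ss Bs)"
          by (auto simp: equation_system_def)
        have "summand_ok s" if "s \<in> set (summands bs ss Bs)" for s
          using that ss by (auto simp: summands_def set_n_lists simples_def)
        moreover have "equation_holds \<C> eqn"
        proof -
          have "denotes \<C> (Full, Bs) = {[1]} \<union> (\<Union>\<pi>\<in>set (oplus # ominus # ss).
            \<Union>Ds\<in>{Ds \<in> set (List.n_lists (length \<pi>) (block_sets bs)). admissible bs Bs \<pi> Ds}.
              inflate_sets \<pi> (map (\<lambda>D. denotes \<C> (Full, D)) Ds))"
            unfolding denotes_Full[OF \<C>] by (rule avoiders_eq_union[OF \<C> ops bs ss Bs])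
          also have "\<dots> = {[1]} \<union> (\<Union>(\<pi>, Ds)\<in>set (summands bs ss Bs). inflate_sets \<pi> (map (denotes \<C>) Ds))"
            unfolding summands_def by (simp add: o_def del: denotes.simps)
          finally show ?thesis unfolding eqn equation_holds.simps .
        qed
        ultimately show "(\<forall>s \<in> set (snd eqn). summand_ok s) \<and> equation_holds \<C> eqn"
          by (simp add: eqn)
      qed
      show "\<forall>(\<delta>, Bs) \<in> unknowns ?sys. \<forall>\<pi> \<in> set Bs. \<exists>\<beta> \<in> basis_star \<C>. normalized_block \<pi> \<beta>"
      proof (intro ballI, clarify)
        fix \<delta> Bs \<gamma> assume "(\<delta>, Bs) \<in> unknowns ?sys" and \<gamma>: "\<gamma> \<in> set Bs"
        then have "Bs \<in> set (block_sets bs)" using sub lhs by auto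
        then have "\<gamma> \<in> set (concat (map proper_blocks bs))"
          using \<gamma> unfolding block_sets_def in_set_subseqs by (blast dest: subseq_set_subset)
        then obtain \<beta> where \<beta>: "\<beta> \<in> basis \<C>" "\<gamma> \<in> set (proper_blocks \<beta>)" using bs by auto
        then show "\<exists>\<beta> \<in> basis_star \<C>. normalized_block \<gamma> \<beta>"
          using proper_block_normalized[of \<beta> \<gamma>] by (auto simp: basis_star_def basis_def)
      qed
      \<comment> \<open>The empty sublist is among the block sets and restricts \<open>\<C>\<close>
        no further, so its equation has \<open>\<C>\<close> on the left.\<close>
      have "denotes \<C> (Full, []) = \<C>" by (simp only: denotes_Full[OF \<C>]) (simp add: avoiders_def)
      moreover have "(Full, []) \<in> lhs_unknowns ?sys" unfolding lhs by (simp add: block_sets_def)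
      ultimately show "\<exists>D \<in> lhs_unknowns ?sys. denotes \<C> D = \<C>" by blast
      show "unknowns ?sys \<subseteq> lhs_unknowns ?sys" by (rule sub)
    qed
  qed
qed

end
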